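(* $\sqrt n\le K_2(\mathrm{Maj}^2)\le\omega(\sqrt n)$. That is: every function $k(n)$ with $k(n)/\sqrt n\to\infty$ (and $k(n)\le n$) belongs to $K_2(\mathrm{Maj}^2)$, and no function $k(n)$ with $k(n)<\sqrt n$ for all $n$ belongs to $K_2(\mathrm{Maj}^2)$.
   Context: $\mathcal{A}(n,k,p)$ is the set of all probability distributions $\mathbb{Q}$ of $n$ bits $(X_1,\ldots,X_n)\in\{0,1\}^n$ that are $k$-wise independent (every subset of at most $k$ of the bits is independent) and satisfy $\mathbb{Q}(X_i=1)=p$ for all $i$. For $f:\{0,1\}^n\to\{0,1\}$, $\varepsilon^f(k,p)=\max_{\mathbb{Q}\in\mathcal{A}(n,k,p)}\mathbb{Q}(f=1)-\min_{\mathbb{Q}\in\mathcal{A}(n,k,p)}\mathbb{Q}(f=1)$. For a sequence $f=(f_n)$ of monotone boolean functions with a sharp threshold at $p_c$ (under fully independent bits with marginal $p$, the probability of $f_n=1$ tends to $0$ for $p<p_c$ and to $1$ for $p>p_c$), $K_2(f)$ is the class of (integer-valued) functions $k(n)$ such that $\varepsilon^{f_n}(k(n),p_c)\to0$ as $n\to\infty$. $\mathrm{Maj}^2$: let $m$ be an odd integer and $n=m^2$. Divide the $n$ input bits into $m$ disjoint sets of size $m$; let $y_i$ be the majority of the bits of the $i$-th set; $\mathrm{Maj}^2_n$ is the majority of $y_1,\ldots,y_m$. The sequence is indexed by $n=m^2$, $m$ odd, and has sharp threshold at $p_c=1/2$. *)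

theory Defs
  imports "HOL-Probability.Probability" "HOL-Library.Discrete_Functions"
begin

text \<open>
  A point of \<open>{0,1}\<^sup>n\<close> is a function \<open>nat \<Rightarrow> bool\<close> that is \<open>False\<close> outside \<open>{..<n}\<close>; this is the
  convention of \<^const>\<open>Pi_pmf\<close>. The \<open>n\<close> bits are the coordinates \<open>i < n\<close>, counted from 0.
\<close>

definition cube :: "nat \<Rightarrow> (nat \<Rightarrow> bool) set" where
  "cube n = PiE_dflt {..<n} False (\<lambda>_. UNIV)"

definition kwise_indep :: "nat \<Rightarrow> nat \<Rightarrow> (nat \<Rightarrow> bool) pmf \<Rightarrow> bool" where
  "kwise_indep n k Q \<longleftrightarrow>
     (\<forall>J. J \<subseteq> {..<n} \<and> card J \<le> k \<longrightarrow>
        prob_space.indep_vars (measure_pmf Q) (\<lambda>_. count_space UNIV) (\<lambda>i x. x i) J)"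

definition kwise_distrs :: "nat \<Rightarrow> nat \<Rightarrow> real \<Rightarrow> (nat \<Rightarrow> bool) pmf set" where
  "kwise_distrs n k p =
     {Q. set_pmf Q \<subseteq> cube n \<and> kwise_indep n k Q \<and>
         (\<forall>i<n. measure_pmf.prob Q {x. x i} = p)}"

text \<open>
  The supremum and the infimum below are a maximum and a minimum; see
  \<open>kwise_distrs_attains_max\<close> and \<open>kwise_distrs_attains_min\<close>.
\<close>

definition eps :: "((nat \<Rightarrow> bool) \<Rightarrow> bool) \<Rightarrow> nat \<Rightarrow> nat \<Rightarrow> real \<Rightarrow> real" where
  "eps f n k p =
     (SUP Q\<in>kwise_distrs n k p. measure_pmf.prob Q {x. f x}) -
     (INF Q\<in>kwise_distrs n k p. measure_pmf.prob Q {x. f x})"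

text \<open>
  A sequence of boolean functions need only exist for the \<open>n\<close> in some infinite set \<open>N\<close>;
  limits for \<open>n \<rightarrow> \<infinity>\<close> are taken along \<open>N\<close>.
\<close>

definition along :: "nat set \<Rightarrow> nat filter" where
  "along N = inf sequentially (principal N)"

definition sharp_threshold :: "nat set \<Rightarrow> (nat \<Rightarrow> (nat \<Rightarrow> bool) \<Rightarrow> bool) \<Rightarrow> real \<Rightarrow> bool" where
  "sharp_threshold N f pc \<longleftrightarrow>
     (\<forall>p. 0 \<le> p \<and> p < pc \<longrightarrow>
        ((\<lambda>n. measure_pmf.prob (Pi_pmf {..<n} False (\<lambda>_. bernoulli_pmf p)) {x. f n x})
          \<longlongrightarrow> 0) (along N)) \<and>
     (\<forall>p. pc < p \<and> p \<le> 1 \<longrightarrow>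
        ((\<lambda>n. measure_pmf.prob (Pi_pmf {..<n} False (\<lambda>_. bernoulli_pmf p)) {x. f n x})
          \<longlongrightarrow> 1) (along N))"

definition K2 :: "nat set \<Rightarrow> (nat \<Rightarrow> (nat \<Rightarrow> bool) \<Rightarrow> bool) \<Rightarrow> real \<Rightarrow> (nat \<Rightarrow> nat) set" where
  "K2 N f pc = {k. ((\<lambda>n. eps (f n) n (k n) pc) \<longlongrightarrow> 0) (along N)}"

definition majority :: "nat \<Rightarrow> (nat \<Rightarrow> bool) \<Rightarrow> bool" where
  "majority m b \<longleftrightarrow> 2 * card {i. i < m \<and> b i} > m"

text \<open>
  For \<open>n = m\<^sup>2\<close> the \<open>i\<close>-th block consists of the bits \<open>i * m + j\<close> with \<open>j < m\<close>. For \<open>n\<close> outside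
  \<open>odd_squares\<close> the value of \<open>Maj2 n\<close> is irrelevant.
\<close>

definition odd_squares :: "nat set" where
  "odd_squares = {m\<^sup>2 | m. odd m}"

definition Maj2 :: "nat \<Rightarrow> (nat \<Rightarrow> bool) \<Rightarrow> bool" where
  "Maj2 n x = (let m = floor_sqrt n in majority m (\<lambda>i. majority m (\<lambda>j. x (i * m + j))))"


subsection \<open>Extremal distributions exist\<close>

lemma finite_cube: "finite (cube n)"
  by (auto simp: cube_def intro: finite_PiE_dflt)

lemma compact_pmf_kwise_distrs: "compact (pmf ` kwise_distrs n k p)"
proof -
  define \<mu> :: "((nat \<Rightarrow> bool) \<Rightarrow> real) \<Rightarrow> (nat \<Rightarrow> bool) set \<Rightarrow> real"
    where "\<mu> = (\<lambda>g S. \<Sum>x\<in>cube n \<inter> S. g x)"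
  have prob: "measure_pmf.prob Q S = \<mu> (pmf Q) S" if "set_pmf Q \<subseteq> cube n" for Q S
  proof -
    have "measure_pmf.prob Q S = measure_pmf.prob Q (cube n \<inter> S)"
      using that by (intro measure_pmf.finite_measure_eq_AE) (auto simp: AE_measure_pmf_iff)
    also have "\<dots> = \<mu> (pmf Q) S"
      unfolding \<mu>_def using finite_cube[of n] by (intro measure_measure_pmf_finite) auto
    finally show ?thesis .
  qed
  define Z where "Z = {g. (\<forall>x. 0 \<le> g x) \<and> (\<forall>x. x \<notin> cube n \<longrightarrow> g x = 0) \<and> \<mu> g UNIV = 1}"
  define V where "V = {g. \<forall>i<n. \<mu> g {x. x i} = p}"
  define W where "W = {g. \<forall>J. J \<subseteq> {..<n} \<and> card J \<le> k \<longrightarrow>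
      (\<forall>I\<subseteq>J. I \<noteq> {} \<longrightarrow> (\<forall>B. \<mu> g (\<Inter>j\<in>I. {x. x j \<in> B j}) = (\<Prod>j\<in>I. \<mu> g {x. x j \<in> B j})))}"
  have kwise: "kwise_indep n k Q \<longleftrightarrow> pmf Q \<in> W" if Q: "set_pmf Q \<subseteq> cube n" for Q
  proof -
    have "prob_space.indep_vars (measure_pmf Q) (\<lambda>_. count_space UNIV) (\<lambda>i x. x i) J \<longleftrightarrow>
        (\<forall>I\<subseteq>J. I \<noteq> {} \<longrightarrow> (\<forall>B. \<mu> (pmf Q) (\<Inter>j\<in>I. {x. x j \<in> B j}) =
            (\<Prod>j\<in>I. \<mu> (pmf Q) {x. x j \<in> B j})))" (is "_ \<longleftrightarrow> ?R") if J: "J \<subseteq> {..<n}" for J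
    proof -
      have fin: "finite I" if "I \<subseteq> J" for I
        using that J by (meson finite_lessThan finite_subset)
      have "prob_space.indep_vars (measure_pmf Q) (\<lambda>_. count_space UNIV) (\<lambda>i x. x i) J \<longleftrightarrow>
        (\<forall>I\<subseteq>J. I \<noteq> {} \<longrightarrow> (\<forall>A\<in>Pi I (\<lambda>i. {(\<lambda>x. x i) -` B | B. True}).
            measure_pmf.prob Q (\<Inter>j\<in>I. A j) = (\<Prod>j\<in>I. measure_pmf.prob Q (A j))))"
        unfolding prob_space.indep_vars_def2[OF measure_pmf.prob_space_axioms]
          prob_space.indep_sets_def[OF measure_pmf.prob_space_axioms]
        by simp (intro all_cong1 imp_cong refl, simp add: fin)
      also have "\<dots> \<longleftrightarrow> ?R" (is "?L \<longleftrightarrow> _")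
      proof
        assume L: ?L
        show ?R
        proof (intro allI impI)
          fix I B assume I: "I \<subseteq> J" "I \<noteq> {}"
          have "(\<lambda>j. {x :: nat \<Rightarrow> bool. x j \<in> B j}) \<in> Pi I (\<lambda>i. {(\<lambda>x. x i) -` B | B. True})"
            by (auto simp: vimage_def)
          with L I have "measure_pmf.prob Q (\<Inter>j\<in>I. {x. x j \<in> B j}) =
              (\<Prod>j\<in>I. measure_pmf.prob Q {x. x j \<in> B j})" by blast
          thus "\<mu> (pmf Q) (\<Inter>j\<in>I. {x. x j \<in> B j}) = (\<Prod>j\<in>I. \<mu> (pmf Q) {x. x j \<in> B j})"
            by (simp add: prob[OF Q])
        qed
      next
        assume R: ?R
        show ?L
        proof (intro allI impI ballI)
          fix I and A :: "nat \<Rightarrow> (nat \<Rightarrow> bool) set"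
          assume I: "I \<subseteq> J" "I \<noteq> {}" and A: "A \<in> Pi I (\<lambda>i. {(\<lambda>x. x i) -` B | B. True})"
          have "\<forall>i\<in>I. \<exists>B. A i = {x. x i \<in> B}"
            using A by (fastforce simp: Pi_iff vimage_def)
          then obtain B where B: "\<And>i. i \<in> I \<Longrightarrow> A i = {x. x i \<in> B i}" by metis
          have "(\<Inter>j\<in>I. A j) = (\<Inter>j\<in>I. {x. x j \<in> B j})" using B by auto
          moreover have "(\<Prod>j\<in>I. measure_pmf.prob Q (A j)) =
              (\<Prod>j\<in>I. measure_pmf.prob Q {x. x j \<in> B j})"
            using B by (intro prod.cong) auto
          ultimately show "measure_pmf.prob Q (\<Inter>j\<in>I. A j) = (\<Prod>j\<in>I. measure_pmf.prob Q (A j))"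
            using R I by (simp add: prob[OF Q])
        qed
      qed
      finally show ?thesis .
    qed
    thus ?thesis
      unfolding kwise_indep_def W_def mem_Collect_eq by (intro all_cong1 imp_cong refl) simp
  qed
  have "pmf ` kwise_distrs n k p = Z \<inter> V \<inter> W"
  proof (intro subset_antisym subsetI)
    fix g assume "g \<in> pmf ` kwise_distrs n k p"
    then obtain Q where Q: "g = pmf Q" "set_pmf Q \<subseteq> cube n" "kwise_indep n k Q"
        "\<forall>i<n. measure_pmf.prob Q {x. x i} = p"
      by (auto simp: kwise_distrs_def)
    have "\<mu> (pmf Q) UNIV = 1" using prob[OF Q(2), of UNIV] by simp
    thus "g \<in> Z \<inter> V \<inter> W"
      using Q kwise[OF Q(2)] prob[OF Q(2)] by (auto simp: Z_def V_def set_pmf_iff)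
  next
    fix g assume g: "g \<in> Z \<inter> V \<inter> W"
    define Q where "Q = embed_pmf g"
    have "(\<integral>\<^sup>+ x. ennreal (g x) \<partial>count_space UNIV) = (\<Sum>x\<in>cube n. ennreal (g x))"
      using g finite_cube by (intro nn_integral_count_space'[of "cube n"]) (auto simp: Z_def)
    also have "\<dots> = ennreal (\<mu> g UNIV)"
      using g by (simp add: \<mu>_def Z_def sum_ennreal)
    finally have pmf: "pmf Q = g"
      unfolding Q_def using g by (intro ext pmf_embed_pmf) (auto simp: Z_def)
    hence supp: "set_pmf Q \<subseteq> cube n" using g by (auto simp: Z_def set_pmf_eq)
    have "Q \<in> kwise_distrs n k p"
      using g supp kwise[OF supp] prob[OF supp] pmf by (auto simp: kwise_distrs_def V_def)
    thus "g \<in> pmf ` kwise_distrs n k p" using pmf by blast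
  qed
  moreover have "closed (Z \<inter> V \<inter> W)"
  proof -
    have [continuous_intros]: "continuous_on UNIV (\<lambda>g. \<mu> g S)" for S
      unfolding \<mu>_def by (intro continuous_intros continuous_on_product_coordinates)
    have "closed Z" unfolding Z_def
      by (intro closed_Collect_conj closed_Collect_all closed_Collect_imp closed_Collect_eq
          closed_Collect_le continuous_intros continuous_on_product_coordinates) auto
    moreover have "closed V" unfolding V_def
      by (intro closed_Collect_all closed_Collect_imp closed_Collect_eq continuous_intros) auto
    moreover have "closed W" unfolding W_def
      by (intro closed_Collect_all closed_Collect_imp closed_Collect_eq continuous_intros) auto
    ultimately show ?thesis by (intro closed_Int)
  qed
  moreover have "pmf ` kwise_distrs n k p \<subseteq> PiE UNIV (\<lambda>_. {0..1})"
    by (auto simp: pmf_le_1)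
  moreover have "compact (PiE UNIV (\<lambda>_. {0..1}) :: ((nat \<Rightarrow> bool) \<Rightarrow> real) set)"
    by (simp only: compactin_PiE compactin_euclidean_iff compact_Icc simp_thms ball_triv
        flip: compactin_euclidean_iff[of "PiE UNIV _"] euclidean_product_topology)
  ultimately show ?thesis
    by (metis closed_Int_compact inf.absorb_iff1)
qed

lemma kwise_distrs_nonempty:
  assumes "0 \<le> p" "p \<le> 1"
  shows "kwise_distrs n k p \<noteq> {}"
proof -
  define Q where "Q = Pi_pmf {..<n} False (\<lambda>_. bernoulli_pmf p)"
  have "set_pmf Q \<subseteq> cube n"
    using set_Pi_pmf_subset'[of "{..<n}" False "\<lambda>_. bernoulli_pmf p"]
    by (auto simp: Q_def cube_def PiE_dflt_def)
  moreover have "kwise_indep n k Q"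
    unfolding kwise_indep_def Q_def
    by (auto intro: prob_space.indep_vars_subset[OF measure_pmf.prob_space_axioms
          indep_vars_Pi_pmf[OF finite_lessThan]])
  moreover have "measure_pmf.prob Q {x. x i} = p" if "i < n" for i
  proof -
    have "measure_pmf.prob Q {x. x i} = measure_pmf.prob (map_pmf (\<lambda>x. x i) Q) {True}"
      by (simp add: vimage_def)
    also have "map_pmf (\<lambda>x. x i) Q = bernoulli_pmf p"
      using that by (simp add: Q_def Pi_pmf_component)
    finally show ?thesis using assms by (simp add: measure_pmf_single)
  qed
  ultimately show ?thesis by (auto simp: kwise_distrs_def)
qed

lemma
  assumes p: "0 \<le> p" "p \<le> 1"
  shows kwise_distrs_attains_max:
      "\<exists>Q\<in>kwise_distrs n k p. \<forall>Q'\<in>kwise_distrs n k p.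
         measure_pmf.prob Q' {x. f x} \<le> measure_pmf.prob Q {x. f x}" (is ?max)
    and kwise_distrs_attains_min:
      "\<exists>Q\<in>kwise_distrs n k p. \<forall>Q'\<in>kwise_distrs n k p.
         measure_pmf.prob Q {x. f x} \<le> measure_pmf.prob Q' {x. f x}" (is ?min)
proof -
  define F :: "((nat \<Rightarrow> bool) \<Rightarrow> real) \<Rightarrow> real" where "F = (\<lambda>g. \<Sum>x\<in>cube n \<inter> {x. f x}. g x)"
  have F: "measure_pmf.prob Q {x. f x} = F (pmf Q)" if "Q \<in> kwise_distrs n k p" for Q
  proof -
    have "measure_pmf.prob Q {x. f x} = measure_pmf.prob Q (cube n \<inter> {x. f x})"
      using that
      by (intro measure_pmf.finite_measure_eq_AE) (auto simp: AE_measure_pmf_iff kwise_distrs_def)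
    also have "\<dots> = F (pmf Q)"
      unfolding F_def using finite_cube[of n] by (intro measure_measure_pmf_finite) auto
    finally show ?thesis .
  qed
  have ne: "pmf ` kwise_distrs n k p \<noteq> {}" using kwise_distrs_nonempty[OF p] by simp
  have "continuous_on UNIV F"
    unfolding F_def by (intro continuous_intros continuous_on_product_coordinates)
  hence cont: "continuous_on (pmf ` kwise_distrs n k p) F"
    by (rule continuous_on_subset) simp
  show ?max
    using continuous_attains_sup[OF compact_pmf_kwise_distrs ne cont] F by auto
  show ?min
    using continuous_attains_inf[OF compact_pmf_kwise_distrs ne cont] F by auto
qed


subsection \<open>Iterated majority is monotone with sharp threshold at 1/2\<close>

lemma floor_sqrt_at_top:
  "filterlim (\<lambda>n. real (floor_sqrt n)) at_top (along N)"
proof -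
  have "filterlim (\<lambda>n. real (floor_sqrt n)) at_top sequentially"
    unfolding filterlim_at_top
  proof
    fix Z :: real
    obtain M :: nat where M: "Z \<le> real M" using real_arch_simple by blast
    have "Z \<le> real (floor_sqrt n)" if "M\<^sup>2 \<le> n" for n
    proof -
      have "M \<le> floor_sqrt n"
        using mono_floor_sqrt'[OF that] by (simp only: floor_sqrt_inverse_power2)
      with M show ?thesis by linarith
    qed
    thus "eventually (\<lambda>n. Z \<le> real (floor_sqrt n)) sequentially"
      by (rule eventually_sequentiallyI)
  qed
  thus ?thesis
    unfolding along_def filterlim_def by (rule order_trans[OF filtermap_mono, rotated]) (rule inf_le1)
qed

lemma along_odd_squares_neq_bot: "along odd_squares \<noteq> bot"
proof
  assume "along odd_squares = bot"
  hence "eventually (\<lambda>n. n \<notin> odd_squares) sequentially"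
    using eventually_inf_principal[of "\<lambda>_. False" sequentially odd_squares]
    by (simp add: along_def)
  then obtain M where M: "\<And>n. n \<ge> M \<Longrightarrow> n \<notin> odd_squares"
    by (auto simp: eventually_sequentially)
  have "M \<le> (2 * M + 1)\<^sup>2" by (simp add: power2_eq_square)
  moreover have "(2 * M + 1)\<^sup>2 \<in> odd_squares"
    unfolding odd_squares_def by (intro CollectI exI[of _ "2 * M + 1"]) simp
  ultimately show False using M by blast
qed

lemma majority_mono:
  assumes "majority m b" "\<And>i. i < m \<Longrightarrow> b i \<Longrightarrow> c i"
  shows "majority m c"
proof -
  have "card {i. i < m \<and> b i} \<le> card {i. i < m \<and> c i}"
    using assms(2) by (intro card_mono) auto
  thus ?thesis using assms(1) by (simp add: majority_def)
qed

lemma mono_Maj2: "mono (Maj2 n)"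
proof (intro monoI le_boolI)
  fix x y :: "nat \<Rightarrow> bool" assume "x \<le> y" "Maj2 n x"
  thus "Maj2 n y"
    unfolding Maj2_def Let_def by (elim majority_mono) (auto simp: le_fun_def elim!: majority_mono)
qed

lemma not_majority:
  assumes "odd m"
  shows "\<not> majority m b \<longleftrightarrow> majority m (\<lambda>i. \<not> b i)"
proof -
  have "card {i. i < m \<and> b i} + card {i. i < m \<and> \<not> b i} = card {..<m}"
    by (subst card_Un_disjoint [symmetric]) (auto intro!: arg_cong[where f = card] simp del: card_lessThan)
  thus ?thesis using assms unfolding majority_def by simp presburger
qed

lemma prob_majority_le:
  fixes Q :: "'a pmf"
  assumes m: "m > 0" and q: "\<And>i. i < m \<Longrightarrow> measure_pmf.prob Q {x. b i x} \<le> q"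
  shows "measure_pmf.prob Q {x. majority m (\<lambda>i. b i x)} \<le> 2 * q"
proof -
  define S where "S = (\<lambda>x. \<Sum>i<m. indicator {x. b i x} x :: real)"
  have S: "S x = real (card {i. i < m \<and> b i x})" for x
  proof -
    have "S x = (\<Sum>i<m. if b i x then 1 else 0)"
      unfolding S_def by (intro sum.cong) (auto simp: indicator_def)
    also have "\<dots> = real (card {i\<in>{..<m}. b i x})"
      by (subst sum.inter_filter [symmetric]) simp_all
    finally show ?thesis by simp
  qed
  have int: "integrable (measure_pmf Q) (\<lambda>x. indicator {x. b i x} x :: real)" for i
    by (intro measure_pmf.integrable_const_bound[of _ 1]) auto
  have "measure_pmf.prob Q {x. majority m (\<lambda>i. b i x)} \<le>
      measure_pmf.prob Q {x \<in> space (measure_pmf Q). S x \<ge> real m / 2}"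
    by (intro measure_pmf.finite_measure_mono) (auto simp: majority_def S)
  also have "\<dots> \<le> measure_pmf.expectation Q S / (real m / 2)"
    using m by (intro integral_Markov_inequality_measure[where A = "{}"])
      (auto simp: S_def int sum_nonneg)
  also have "measure_pmf.expectation Q S = (\<Sum>i<m. measure_pmf.prob Q {x. b i x})"
    unfolding S_def by (subst Bochner_Integration.integral_sum) (auto simp: int)
  also have "\<dots> \<le> real m * q"
    using sum_mono[of "{..<m}" "\<lambda>i. measure_pmf.prob Q {x. b i x}" "\<lambda>_. q"] q by simp
  finally show ?thesis using m by (simp add: divide_simps mult_ac)
qed

lemma prob_block_le:
  fixes \<beta> :: bool
  assumes p: "0 \<le> p" "p \<le> 1" and q: "q = (if \<beta> then p else 1 - p)" "q < 1/2"
    and m: "m > 0" and i: "i < m"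
  shows "measure_pmf.prob (Pi_pmf {..<m\<^sup>2} False (\<lambda>_. bernoulli_pmf p))
           {x. majority m (\<lambda>j. x (i * m + j) = \<beta>)} \<le> exp (- 2 * (1/2 - q)\<^sup>2 * real m)"
proof -
  define Q where "Q = Pi_pmf {..<m\<^sup>2} False (\<lambda>_. bernoulli_pmf p)"
  define K where "K = (\<lambda>j. i * m + j) ` {..<m}"
  define X where "X = (\<lambda>k x. of_bool (x (k :: nat) = \<beta>) :: real)"
  have inj: "inj_on (\<lambda>j. i * m + j) {..<m}"
    by (auto simp: inj_on_def)
  have card_K: "card K = m"
    unfolding K_def by (simp add: card_image[OF inj])
  have sub: "K \<subseteq> {..<m\<^sup>2}"
  proof
    fix k assume "k \<in> K"
    then obtain j where j: "k = i * m + j" "j < m" by (auto simp: K_def)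
    have "i * m + j < (i + 1) * m" using j by simp
    also have "\<dots> \<le> m * m" using i by (intro mult_right_mono) auto
    finally show "k \<in> {..<m\<^sup>2}" by (simp add: j power2_eq_square)
  qed
  have ind: "prob_space.indep_vars (measure_pmf Q) (\<lambda>_. borel) X K"
  proof -
    have "prob_space.indep_vars (measure_pmf Q) (\<lambda>_. count_space UNIV) (\<lambda>k x. x k) K"
      unfolding Q_def using sub
      by (intro prob_space.indep_vars_subset[OF measure_pmf.prob_space_axioms
            indep_vars_Pi_pmf[OF finite_lessThan]]) auto
    thus ?thesis
      unfolding X_def
      by (rule prob_space.indep_vars_compose2[OF measure_pmf.prob_space_axioms]) auto
  qed
  have ex: "measure_pmf.expectation Q (X k) = q" if "k \<in> K" for k
  proof -
    have "measure_pmf.expectation Q (X k) =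
        measure_pmf.expectation (map_pmf (\<lambda>x. x k) Q) (\<lambda>c. of_bool (c = \<beta>))"
      by (simp add: X_def)
    also have "map_pmf (\<lambda>x. x k) Q = bernoulli_pmf p"
      using sub that by (auto simp: Q_def Pi_pmf_component)
    also have "measure_pmf.expectation (bernoulli_pmf p) (\<lambda>c. of_bool (c = \<beta>)) = q"
      using p q(1) by simp
    finally show ?thesis .
  qed
  have "indep_interval_bounded_random_variables (measure_pmf Q) K X (\<lambda>_. 0) (\<lambda>_. 1)"
    by (intro indep_interval_bounded_random_variables.intro measure_pmf.prob_space_axioms
        indep_interval_bounded_random_variables_axioms.intro ind)
       (auto simp: X_def K_def)
  then interpret Hoeffding_ineq "measure_pmf Q" K X "\<lambda>_. 0" "\<lambda>_. 1"
      "\<Sum>k\<in>K. measure_pmf.expectation Q (X k)"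
    by (simp add: Hoeffding_ineq_def)
  have mean: "(\<Sum>k\<in>K. measure_pmf.expectation Q (X k)) = real m * q"
    by (simp add: ex card_K)
  have S: "(\<Sum>k\<in>K. X k x) = real (card {j. j < m \<and> x (i * m + j) = \<beta>})" for x
  proof -
    have "(\<Sum>k\<in>K. X k x) = (\<Sum>j<m. if x (i * m + j) = \<beta> then 1 else 0)"
      unfolding X_def K_def by (subst sum.reindex[OF inj], unfold o_def, intro sum.cong) auto
    also have "\<dots> = real (card {j\<in>{..<m}. x (i * m + j) = \<beta>})"
      by (subst sum.inter_filter [symmetric]) simp_all
    finally show ?thesis by simp
  qed
  have "measure_pmf.prob Q {x. majority m (\<lambda>j. x (i * m + j) = \<beta>)} \<le>
      measure_pmf.prob Q {x \<in> space (measure_pmf Q).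
        (\<Sum>k\<in>K. X k x) \<ge> real m * q + real m * (1/2 - q)}"
    by (intro measure_pmf.finite_measure_mono) (auto simp: majority_def S algebra_simps)
  also have "\<dots> \<le> exp (- 2 * (real m * (1/2 - q))\<^sup>2 / (\<Sum>k\<in>K. (1 - 0)\<^sup>2))"
    by (rule Hoeffding_ineq_ge[unfolded mean]) (use m q(2) card_K in simp_all)
  also have "- 2 * (real m * (1/2 - q))\<^sup>2 / (\<Sum>k\<in>K. (1 - 0)\<^sup>2) = - 2 * (1/2 - q)\<^sup>2 * real m"
    using m by (simp add: card_K power2_eq_square)
  finally show ?thesis by (simp add: Q_def)
qed

lemma sharp_threshold_Maj2: "sharp_threshold odd_squares Maj2 (1/2)"
proof -
  let ?P = "\<lambda>p n. Pi_pmf {..<n} False (\<lambda>_. bernoulli_pmf p)"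
  have bound: "measure_pmf.prob (?P p n) {x. Maj2 n x \<longleftrightarrow> \<beta>} \<le>
      2 * exp (- 2 * (1/2 - q)\<^sup>2 * real (floor_sqrt n))"
    if p: "0 \<le> p" "p \<le> 1" "q = (if \<beta> then p else 1 - p)" "q < 1/2" and n: "n \<in> odd_squares"
    for p q \<beta> n
  proof -
    obtain m where m: "n = m\<^sup>2" "odd m" using n by (auto simp: odd_squares_def)
    have "(Maj2 n x \<longleftrightarrow> \<beta>) \<longleftrightarrow> majority m (\<lambda>i. majority m (\<lambda>j. x (i * m + j) = \<beta>))" for x
      using m by (cases \<beta>) (simp_all add: Maj2_def Let_def not_majority)
    moreover have "m > 0" using m(2) by (simp add: odd_pos)
    ultimately show ?thesis
      using m(1) prob_majority_le[OF _ prob_block_le[OF p]] by simp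
  qed
  have lim: "((\<lambda>n. measure_pmf.prob (?P p n) {x. Maj2 n x \<longleftrightarrow> \<beta>}) \<longlongrightarrow> 0) (along odd_squares)"
    if p: "0 \<le> p" "p \<le> 1" "q = (if \<beta> then p else 1 - p)" "q < 1/2" for p q \<beta>
  proof (rule tendsto_sandwich[where f = "\<lambda>_. 0"])
    show "\<forall>\<^sub>F n in along odd_squares. measure_pmf.prob (?P p n) {x. Maj2 n x \<longleftrightarrow> \<beta>} \<le>
        2 * exp (- 2 * (1/2 - q)\<^sup>2 * real (floor_sqrt n))"
      unfolding along_def eventually_inf_principal using bound[OF p] by (intro always_eventually) auto
    have "((\<lambda>t. 2 * exp (- 2 * (1/2 - q)\<^sup>2 * t)) \<longlongrightarrow> 0) at_top"
    proof -
      have c: "- 2 * (1/2 - q)\<^sup>2 < 0" using p(4) by simp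
      have "filterlim (\<lambda>t. - 2 * (1/2 - q)\<^sup>2 * t) at_bot at_top"
        using c by (intro filterlim_tendsto_neg_mult_at_bot[OF tendsto_const]) (auto simp: filterlim_ident)
      from filterlim_compose[OF exp_at_bot this] show ?thesis
        using tendsto_mult_right_zero by blast
    qed
    from filterlim_compose[OF this floor_sqrt_at_top]
    show "((\<lambda>n. 2 * exp (- 2 * (1/2 - q)\<^sup>2 * real (floor_sqrt n))) \<longlongrightarrow> 0) (along odd_squares)" .
  qed auto
  show ?thesis
    unfolding sharp_threshold_def
  proof (intro conjI allI impI)
    fix p :: real assume "0 \<le> p \<and> p < 1/2"
    thus "((\<lambda>n. measure_pmf.prob (?P p n) {x. Maj2 n x}) \<longlongrightarrow> 0) (along odd_squares)"
      using lim[of p p True] by simp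
  next
    fix p :: real assume "1/2 < p \<and> p \<le> 1"
    hence "((\<lambda>n. 1 - measure_pmf.prob (?P p n) {x. \<not> Maj2 n x}) \<longlongrightarrow> 1 - 0) (along odd_squares)"
      using lim[of p "1 - p" False] by (intro tendsto_diff tendsto_const) simp
    moreover have "1 - measure_pmf.prob (?P p n) {x. \<not> Maj2 n x} =
        measure_pmf.prob (?P p n) {x. Maj2 n x}" for n
      using measure_pmf.prob_compl[of "{x. \<not> Maj2 n x}" "?P p n"]
      by (simp add: Compl_eq_Diff_UNIV [symmetric] Collect_neg_eq)
    ultimately show "((\<lambda>n. measure_pmf.prob (?P p n) {x. Maj2 n x}) \<longlongrightarrow> 1) (along odd_squares)"
      by simp
  qed
qed

end

theory Submission
  imports Defs "HOL-Real_Asymp.Real_Asymp"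
begin

text \<open>
  Write \<open>n = m\<^sup>2\<close>. If the input bits are \<open>t * m\<close>-wise independent, then the \<open>m\<close> block majorities are
  \<open>t\<close>-wise independent fair bits, and their normalized sum of signs has the same first \<open>t\<close> moments as
  under full independence. For \<open>t \<rightarrow> \<infinity>\<close> the Taylor expansion of the characteristic function and
  Levy's continuity theorem give convergence to the normal distribution, so the outer majority is
  asymptotically fair.

  Conversely, let the blocks be independent and each of them uniform on the bit vectors of one
  fixed parity. These bits are \<open>(m - 1)\<close>-wise independent, but for the right parity each block
  majority is biased by an amount of order \<open>1 / sqrt m\<close>. With \<open>m\<close> independent blocks, this shifts the
  probability of the outer majority by a constant.
\<close>

subsection \<open>Restricting a distribution to few coordinates\<close>

text \<open>Bits outside \<open>J\<close> become \<open>False\<close> instead of being dropped.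
  Projections onto different \<open>J\<close> thus live in one type and obey the default-value
  convention of \<open>Pi_pmf\<close>.\<close>

definition proj :: "'a set \<Rightarrow> ('a \<Rightarrow> bool) \<Rightarrow> 'a \<Rightarrow> bool" where
  "proj J x = (\<lambda>i. i \<in> J \<and> x i)"

definition coins :: "'a set \<Rightarrow> ('a \<Rightarrow> bool) pmf" where
  "coins J = Pi_pmf J False (\<lambda>_. bernoulli_pmf (1/2))"

text \<open>Independence says that the joint law is the product of the marginal laws, and a
  pushforward can be absorbed into both. This characterization needs a nonempty index set, so
  \<open>I = {}\<close> is treated apart.\<close>

lemma indep_vars_map_pmf_iff:
  "prob_space.indep_vars (measure_pmf (map_pmf f Q)) (\<lambda>_. count_space UNIV) X I \<longleftrightarrow>
     prob_space.indep_vars (measure_pmf Q) (\<lambda>_. count_space UNIV) (\<lambda>i x. X i (f x)) I"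
proof (cases "I = {}")
  case True
  thus ?thesis
    by (simp add: prob_space.indep_vars_def[OF measure_pmf.prob_space_axioms]
        prob_space.indep_sets_def[OF measure_pmf.prob_space_axioms])
next
  case False
  have "prob_space.indep_vars (measure_pmf (map_pmf f Q)) (\<lambda>_. count_space UNIV) X I \<longleftrightarrow>
      distr (measure_pmf (map_pmf f Q)) (\<Pi>\<^sub>M i\<in>I. count_space UNIV) (\<lambda>x. \<lambda>i\<in>I. X i x) =
        (\<Pi>\<^sub>M i\<in>I. distr (measure_pmf (map_pmf f Q)) (count_space UNIV) (X i))"
    by (rule prob_space.indep_vars_iff_distr_eq_PiM[OF measure_pmf.prob_space_axioms False]) simp
  also have "\<dots> \<longleftrightarrow>
      distr (measure_pmf Q) (\<Pi>\<^sub>M i\<in>I. count_space UNIV) (\<lambda>x. \<lambda>i\<in>I. X i (f x)) =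
        (\<Pi>\<^sub>M i\<in>I. distr (measure_pmf Q) (count_space UNIV) (\<lambda>x. X i (f x)))"
    unfolding map_pmf_rep_eq by (simp add: distr_distr o_def space_PiM)
  also have "\<dots> \<longleftrightarrow> prob_space.indep_vars (measure_pmf Q) (\<lambda>_. count_space UNIV) (\<lambda>i x. X i (f x)) I"
    by (rule prob_space.indep_vars_iff_distr_eq_PiM[OF measure_pmf.prob_space_axioms False, symmetric]) simp
  finally show ?thesis .
qed

lemma prob_Pi_pmf_bernoulli_component:
  assumes "finite J" "i \<in> J" "0 \<le> p" "p \<le> 1"
  shows "measure_pmf.prob (Pi_pmf J False (\<lambda>_. bernoulli_pmf p)) {x. x i} = p"
proof -
  have "measure_pmf.prob (Pi_pmf J False (\<lambda>_. bernoulli_pmf p)) {x. x i} =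
      measure_pmf.prob (map_pmf (\<lambda>x. x i) (Pi_pmf J False (\<lambda>_. bernoulli_pmf p))) {True}"
    by (simp add: vimage_def)
  also have "map_pmf (\<lambda>x. x i) (Pi_pmf J False (\<lambda>_. bernoulli_pmf p)) = bernoulli_pmf p"
    using assms by (simp add: Pi_pmf_component)
  finally show ?thesis using assms by (simp add: measure_pmf_single)
qed

text \<open>For finitely many bits the joint law is determined by its point probabilities, and
  independence makes these the products that define \<open>Pi_pmf\<close>. From here on k-wise
  independence is handled as an equation between pmfs.\<close>

lemma indep_bits_iff_map_proj:
  fixes Q :: "('a \<Rightarrow> bool) pmf"
  assumes J: "finite J" and p: "0 \<le> p" "p \<le> 1"
  shows "prob_space.indep_vars (measure_pmf Q) (\<lambda>_. count_space UNIV) (\<lambda>i x. x i) J \<and>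
      (\<forall>i\<in>J. measure_pmf.prob Q {x. x i} = p) \<longleftrightarrow>
    map_pmf (proj J) Q = Pi_pmf J False (\<lambda>_. bernoulli_pmf p)" (is "?L \<longleftrightarrow> ?M = ?P")
proof
  assume L: ?L
  show "?M = ?P"
  proof (rule pmf_eqI)
    fix v
    have M: "pmf ?M v = measure_pmf.prob Q {x. proj J x = v}"
      by (simp add: pmf_map vimage_def)
    show "pmf ?M v = pmf ?P v"
    proof (cases "\<exists>i. i \<notin> J \<and> v i")
      case True
      hence "{x. proj J x = v} = {}" by (auto simp: proj_def)
      moreover have "pmf ?P v = 0" using True J by (intro pmf_Pi_outside) auto
      ultimately show ?thesis unfolding M by simp
    next
      case False
      have single: "measure_pmf.prob Q {x. x i = v i} = pmf (bernoulli_pmf p) (v i)" if "i \<in> J" for i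
      proof -
        have "measure_pmf.prob Q {x. \<not> x i} = 1 - p"
          using measure_pmf.prob_compl[of "{x. x i}" Q] L that
          by (simp add: Compl_eq_Diff_UNIV [symmetric] Collect_neg_eq)
        thus ?thesis using L that p by (cases "v i") auto
      qed
      have eq: "{x. proj J x = v} = (\<Inter>i\<in>J. {x. x i = v i})"
        using False by (auto simp: proj_def fun_eq_iff)
      have "measure_pmf.prob Q (\<Inter>i\<in>J. {x. x i = v i}) =
          (\<Prod>i\<in>J. measure_pmf.prob Q {x. x i = v i})"
      proof (cases "J = {}")
        case False
        show ?thesis
          using prob_space.indep_varsD_finite[OF measure_pmf.prob_space_axioms conjunct1[OF L] False J,
              where A = "\<lambda>i. {v i}"]
          by (simp add: vimage_def)
      qed simp
      also have "\<dots> = (\<Prod>i\<in>J. pmf (bernoulli_pmf p) (v i))"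
        by (intro prod.cong refl single)
      also have "\<dots> = pmf ?P v"
        using False J by (subst pmf_Pi') auto
      finally show ?thesis unfolding M eq .
    qed
  qed
next
  assume eq: "?M = ?P"
  have "prob_space.indep_vars (measure_pmf ?M) (\<lambda>_. count_space UNIV) (\<lambda>i x. x i) J"
    unfolding eq by (rule indep_vars_Pi_pmf[OF J])
  hence "prob_space.indep_vars (measure_pmf Q) (\<lambda>_. count_space UNIV) (\<lambda>i x. proj J x i) J"
    by (simp only: indep_vars_map_pmf_iff)
  hence "prob_space.indep_vars (measure_pmf Q) (\<lambda>_. count_space UNIV) (\<lambda>i x. x i) J"
    by (subst (asm) prob_space.indep_vars_cong[OF measure_pmf.prob_space_axioms refl _ refl,
          where Y = "\<lambda>i x. x i"]) (auto simp: proj_def)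
  moreover have "measure_pmf.prob Q {x. x i} = p" if "i \<in> J" for i
  proof -
    have "measure_pmf.prob Q {x. x i} = measure_pmf.prob ?M {x. x i}"
      using that by (simp add: vimage_def proj_def)
    thus ?thesis
      unfolding eq using prob_Pi_pmf_bernoulli_component[OF J that p] by simp
  qed
  ultimately show ?L by blast
qed

lemma map_proj_kwise_distrs:
  assumes "Q \<in> kwise_distrs n k (1/2)" "J \<subseteq> {..<n}" "card J \<le> k"
  shows "map_pmf (proj J) Q = coins J"
  using assms indep_bits_iff_map_proj[of J "1/2" Q] finite_subset[OF assms(2)]
  by (auto simp: coins_def kwise_distrs_def kwise_indep_def)

lemma kwise_distrsI:
  assumes "k \<ge> 1" "set_pmf Q \<subseteq> cube n"
    and eq: "\<And>J. J \<subseteq> {..<n} \<Longrightarrow> card J \<le> k \<Longrightarrow> map_pmf (proj J) Q = coins J"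
  shows "Q \<in> kwise_distrs n k (1/2)"
proof -
  have *: "prob_space.indep_vars (measure_pmf Q) (\<lambda>_. count_space UNIV) (\<lambda>i x. x i) J \<and>
      (\<forall>i\<in>J. measure_pmf.prob Q {x. x i} = 1/2)" if "J \<subseteq> {..<n}" "card J \<le> k" for J
    using eq[OF that] indep_bits_iff_map_proj[of J "1/2" Q] finite_subset[OF that(1)]
    by (auto simp: coins_def)
  \<comment> \<open>The marginals are read off from singletons \<open>J = {i}\<close>, which
    requires \<open>1 \<le> k\<close>.\<close>
  have "measure_pmf.prob Q {x. x i} = 1/2" if "i < n" for i
    using *[of "{i}"] that assms(1) by simp
  with * assms(2) show ?thesis by (auto simp: kwise_distrs_def kwise_indep_def)
qed

lemma kwise_distrs_antimono: "k \<le> k' \<Longrightarrow> kwise_distrs n k' p \<subseteq> kwise_distrs n k p"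
  by (auto simp: kwise_distrs_def kwise_indep_def)

lemma set_coins: "finite J \<Longrightarrow> set_pmf (coins J) = PiE_dflt J False (\<lambda>_. UNIV)"
  by (simp add: coins_def set_Pi_pmf bernoulli_pmf_half_conv_pmf_of_set o_def)

lemma coins_eq_pmf_of_set: "finite J \<Longrightarrow> coins J = pmf_of_set (PiE_dflt J False (\<lambda>_. UNIV))"
  by (simp add: coins_def bernoulli_pmf_half_conv_pmf_of_set Pi_pmf_of_set)

lemma map_proj_coins: "finite J \<Longrightarrow> I \<subseteq> J \<Longrightarrow> map_pmf (proj I) (coins J) = coins I"
  unfolding coins_def by (subst Pi_pmf_subset[of J I]) (auto simp: proj_def intro!: map_pmf_cong)

lemma coins_kwise_distrs: "coins {..<n} \<in> kwise_distrs n k (1/2)"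
proof -
  \<comment> \<open>\<open>Suc k\<close> makes the introduction rule applicable also for
    \<open>k = 0\<close>.\<close>
  have "coins {..<n} \<in> kwise_distrs n (Suc k) (1/2)"
    by (rule kwise_distrsI) (auto simp: set_coins cube_def map_proj_coins)
  thus ?thesis using kwise_distrs_antimono[of k "Suc k"] by auto
qed

text \<open>Negating all bits permutes the cube and so preserves its uniform distribution;
  \<open>proj J\<close> restores the default value outside \<open>J\<close>.\<close>

lemma map_Not_coins:
  assumes "finite J"
  shows "map_pmf (\<lambda>x. proj J (\<lambda>i. \<not> x i)) (coins J) = coins J"
proof -
  have "bij_betw (\<lambda>x. proj J (\<lambda>i. \<not> x i)) (PiE_dflt J False (\<lambda>_. UNIV)) (PiE_dflt J False (\<lambda>_. UNIV))"
    by (rule bij_betwI[where g = "\<lambda>x. proj J (\<lambda>i. \<not> x i)"]) (auto simp: proj_def PiE_dflt_def)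
  thus ?thesis
    unfolding coins_eq_pmf_of_set[OF assms]
    using assms by (intro map_pmf_of_set_bij_betw) auto
qed

text \<open>Negation exchanges the event with its complement, as ties cannot occur for odd
  \<open>m\<close>.\<close>

lemma prob_coins_majority:
  assumes "odd m"
  shows "measure_pmf.prob (coins {..<m}) {b. majority m b} = 1/2"
proof -
  let ?U = "measure_pmf.prob (coins {..<m})"
  have "?U {b. majority m b} =
      measure_pmf.prob (map_pmf (\<lambda>x. proj {..<m} (\<lambda>i. \<not> x i)) (coins {..<m})) {b. majority m b}"
    by (simp only: map_Not_coins finite_lessThan)
  also have "\<dots> = ?U {b. majority m (\<lambda>i. \<not> b i)}"
    by (simp add: vimage_def majority_def proj_def cong: conj_cong)
  also have "\<dots> = ?U (UNIV - {b. majority m b})"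
    using not_majority[OF assms] by (intro arg_cong[where f = ?U]) auto
  also have "\<dots> = 1 - ?U {b. majority m b}"
    using measure_pmf.prob_compl[of "{b. majority m b}" "coins {..<m}"] by simp
  finally show ?thesis by simp
qed

subsection \<open>Block structure\<close>

text \<open>Here the map may vary with the coordinate; this is needed to project each block onto its
  own set of positions. The product of the maps is a bind with point masses, and a product of point
  masses is a point mass.\<close>

lemma Pi_pmf_map_dep:
  assumes "finite A" "\<And>x. x \<notin> A \<Longrightarrow> f x d = d'"
  shows "Pi_pmf A d' (\<lambda>x. map_pmf (f x) (g x)) = map_pmf (\<lambda>h x. f x (h x)) (Pi_pmf A d g)"
proof -
  have "Pi_pmf A d' (\<lambda>x. map_pmf (f x) (g x)) =
      Pi_pmf A d g \<bind> (\<lambda>h. Pi_pmf A d' (\<lambda>x. return_pmf (f x (h x))))"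
    using assms(1) by (simp add: map_pmf_def Pi_pmf_bind[where d' = d] del: Pi_pmf_return_pmf)
  also have "\<dots> = map_pmf (\<lambda>h x. f x (h x)) (Pi_pmf A d g)"
    unfolding map_pmf_def using set_Pi_pmf_subset'[OF assms(1), of d g] assms
    by (intro bind_pmf_cong refl)
      (auto simp: Pi_pmf_return_pmf PiE_dflt_def fun_eq_iff intro!: arg_cong[of _ _ return_pmf])
  finally show ?thesis .
qed

lemma bool_pmf_eq_bernoulli: "p = bernoulli_pmf (pmf p True)"
proof (rule pmf_eqI)
  show "pmf p b = pmf (bernoulli_pmf (pmf p True)) b" for b
    by (cases b) (simp_all add: pmf_le_1 pmf_False_conv_True[of p])
qed

lemma block_index_less:
  fixes i j m :: nat
  assumes "i < m" "j < m"
  shows "i * m + j < m * m"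
proof -
  have "i * m + j < (i + 1) * m" using assms by simp
  also have "\<dots> \<le> m * m" using assms by (intro mult_right_mono) auto
  finally show ?thesis .
qed

text \<open>Inverse of cutting the input into \<open>m\<close> blocks: position
  \<open>i * m + j\<close> receives bit \<open>j\<close> of block \<open>i\<close>. The guard keeps
  the result in the cube.\<close>

definition glue :: "nat \<Rightarrow> (nat \<Rightarrow> nat \<Rightarrow> bool) \<Rightarrow> nat \<Rightarrow> bool" where
  "glue m B = (\<lambda>l. l < m * m \<and> B (l div m) (l mod m))"

definition block_maj :: "nat \<Rightarrow> (nat \<Rightarrow> bool) \<Rightarrow> nat \<Rightarrow> bool" where
  "block_maj m x = (\<lambda>i. i < m \<and> majority m (\<lambda>j. x (i * m + j)))"

lemma majority_cong: "(\<And>i. i < m \<Longrightarrow> b i = c i) \<Longrightarrow> majority m b = majority m c"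
  by (simp add: majority_def cong: conj_cong)

lemma majority_False [simp]: "\<not> majority m (\<lambda>_. False)"
  by (simp add: majority_def)

lemma Maj2_eq: "Maj2 (m\<^sup>2) x = majority m (block_maj m x)"
  by (auto simp: Maj2_def Let_def block_maj_def intro!: majority_cong)

text \<open>Gluing is a bijection from families of \<open>m\<close> blocks onto the cube, so it
  carries the uniform distribution to the uniform distribution.\<close>

lemma map_glue_coins:
  "map_pmf (glue m) (Pi_pmf {..<m} (\<lambda>_. False) (\<lambda>_. coins {..<m})) = coins {..<m * m}"
proof -
  let ?C = "PiE_dflt {..<m} (\<lambda>_. False) (\<lambda>_. PiE_dflt {..<m} False (\<lambda>_. UNIV :: bool set))"
  have fin: "finite ?C" by (intro finite_PiE_dflt) auto
  have "bij_betw (glue m) ?C (PiE_dflt {..<m * m} False (\<lambda>_. UNIV))"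
  proof (rule bij_betwI[where g = "\<lambda>x i j. i < m \<and> j < m \<and> x (i * m + j)"])
    fix B assume B: "B \<in> ?C"
    show "(\<lambda>i j. i < m \<and> j < m \<and> glue m B (i * m + j)) = B"
    proof (intro ext)
      fix i j
      have "B i j \<longleftrightarrow> i < m \<and> j < m \<and> B i j"
        using B by (cases "i < m"; cases "j < m") (auto simp: PiE_dflt_def not_less)
      thus "(i < m \<and> j < m \<and> glue m B (i * m + j)) = B i j"
        by (auto simp: glue_def block_index_less)
    qed
  next
    fix x :: "nat \<Rightarrow> bool" assume x: "x \<in> PiE_dflt {..<m * m} False (\<lambda>_. UNIV)"
    have "l div m < m \<and> l mod m < m" if "l < m * m" for l
      using that by (cases "m = 0") (auto simp: less_mult_imp_div_less)
    thus "glue m (\<lambda>i j. i < m \<and> j < m \<and> x (i * m + j)) = x"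
      using x by (auto simp: glue_def PiE_dflt_def fun_eq_iff)
  qed (auto simp: glue_def PiE_dflt_def)
  hence "map_pmf (glue m) (pmf_of_set ?C) = pmf_of_set (PiE_dflt {..<m * m} False (\<lambda>_. UNIV))"
    using fin by (intro map_pmf_of_set_bij_betw) auto
  thus ?thesis
    by (simp add: coins_eq_pmf_of_set Pi_pmf_of_set finite_PiE_dflt)
qed

text \<open>Each block majority looks at its own block only, so independent blocks with law
  \<open>R\<close> yield independent bits.\<close>

lemma map_block_maj_glue:
  "map_pmf (block_maj m) (map_pmf (glue m) (Pi_pmf {..<m} (\<lambda>_. False) (\<lambda>_. R))) =
     Pi_pmf {..<m} False (\<lambda>_. map_pmf (majority m) R)"
proof -
  have eq: "block_maj m (glue m B) = (\<lambda>i. majority m (B i))"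
    if "B \<in> set_pmf (Pi_pmf {..<m} (\<lambda>_. False) (\<lambda>_. R))" for B
  proof
    fix i
    have "B i = (\<lambda>_. False)" if "\<not> i < m"
      using that \<open>B \<in> _\<close> set_Pi_pmf_subset'[of "{..<m}" "\<lambda>_. False" "\<lambda>_. R"]
      by (auto simp: PiE_dflt_def)
    thus "block_maj m (glue m B) i = majority m (B i)"
      by (cases "i < m") (auto simp: block_maj_def glue_def block_index_less intro!: majority_cong)
  qed
  show ?thesis
    by (subst Pi_pmf_map_dep[where d = "\<lambda>_. False"])
      (auto simp: pmf.map_comp o_def eq intro!: map_pmf_cong)
qed

text \<open>Any \<open>t\<close> block majorities depend on at most \<open>t * m\<close> input bits,
  and on these \<open>Q\<close> cannot be told from fair coins. For fair coins the block majorities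
  are independent and fair.\<close>

lemma block_maj_kwise_distrs:
  assumes "odd m" "1 \<le> t" "t * m \<le> k" and Q: "Q \<in> kwise_distrs (m * m) k (1/2)"
  shows "map_pmf (block_maj m) Q \<in> kwise_distrs m t (1/2)"
proof (rule kwise_distrsI)
  have "map_pmf (block_maj m) (coins {..<m * m}) =
      Pi_pmf {..<m} False (\<lambda>_. map_pmf (majority m) (coins {..<m}))"
    unfolding map_glue_coins[symmetric] map_block_maj_glue ..
  also have "map_pmf (majority m) (coins {..<m}) = bernoulli_pmf (1/2)"
  proof -
    have "pmf (map_pmf (majority m) (coins {..<m})) True = measure_pmf.prob (coins {..<m}) {b. majority m b}"
      by (simp add: pmf_map vimage_def)
    thus ?thesis by (metis bool_pmf_eq_bernoulli prob_coins_majority[OF assms(1)])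
  qed
  finally have U: "map_pmf (block_maj m) (coins {..<m * m}) = coins {..<m}"
    by (simp add: coins_def)
  fix I assume I: "I \<subseteq> {..<m}" "card I \<le> t"
  \<comment> \<open>All input positions of the blocks in \<open>I\<close>.\<close>
  define J where "J = (\<lambda>(i, j). i * m + j) ` (I \<times> {..<m})"
  have J: "J \<subseteq> {..<m * m}"
    using I block_index_less by (auto simp: J_def)
  have "card J \<le> card (I \<times> {..<m})"
    unfolding J_def using finite_subset[OF I(1)] by (intro card_image_le) auto
  also have "\<dots> \<le> k"
    using order_trans[OF mult_le_mono1[OF I(2), of m] assms(3)] by (simp add: card_cartesian_product)
  finally have card_J: "card J \<le> k" .
  have dep: "proj I (block_maj m (proj J x)) = proj I (block_maj m x)" for x
  proof -
    have "proj J x (i * m + j) = x (i * m + j)" if "i \<in> I" "j < m" for i j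
      using that unfolding proj_def J_def by force
    hence "majority m (\<lambda>j. proj J x (i * m + j)) = majority m (\<lambda>j. x (i * m + j))" if "i \<in> I" for i
      using that by (intro majority_cong) blast
    thus ?thesis by (auto simp: proj_def[of I] block_maj_def fun_eq_iff)
  qed
  have "map_pmf (proj I) (map_pmf (block_maj m) Q) =
      map_pmf (\<lambda>x. proj I (block_maj m x)) (map_pmf (proj J) Q)"
    by (simp add: pmf.map_comp o_def dep)
  also have "map_pmf (proj J) Q = map_pmf (proj J) (coins {..<m * m})"
    using map_proj_kwise_distrs[OF Q J card_J] J by (simp add: map_proj_coins)
  also have "map_pmf (\<lambda>x. proj I (block_maj m x)) \<dots> = map_pmf (proj I) (map_pmf (block_maj m) (coins {..<m * m}))"
    by (simp add: pmf.map_comp o_def dep)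
  also have "\<dots> = map_pmf (proj I) (coins {..<m})" by (simp only: U)
  also have "\<dots> = coins I" using I by (simp add: map_proj_coins)
  finally show "map_pmf (proj I) (map_pmf (block_maj m) Q) = coins I" .
qed (use assms(2) in \<open>auto simp: cube_def PiE_dflt_def block_maj_def\<close>)

text \<open>A set of at most \<open>m - 1\<close> positions misses some position of every block, so
  each block is observed on a proper subset only, where \<open>R\<close> looks like fair coins. The
  blocks themselves are independent.\<close>

lemma glue_kwise_distrs:
  assumes "2 \<le> m" and R: "\<And>J. J \<subset> {..<m} \<Longrightarrow> map_pmf (proj J) R = coins J"
  shows "map_pmf (glue m) (Pi_pmf {..<m} (\<lambda>_. False) (\<lambda>_. R)) \<in> kwise_distrs (m * m) (m - 1) (1/2)"
proof (rule kwise_distrsI)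
  fix J assume J: "J \<subseteq> {..<m * m}" "card J \<le> m - 1"
  \<comment> \<open>The trace of \<open>J\<close> on block \<open>i\<close>.\<close>
  define K where "K = (\<lambda>i. {j. j < m \<and> i * m + j \<in> J})"
  have K: "K i \<subset> {..<m}" for i
  proof -
    have "card ((\<lambda>j. i * m + j) ` K i) \<le> card J"
      using finite_subset[OF J(1)] by (intro card_mono) (auto simp: K_def)
    hence "card (K i) < m"
      using J assms(1) card_image[of "\<lambda>j. i * m + j" "K i"] by (simp add: inj_on_def)
    moreover have "K i \<subseteq> {..<m}" by (auto simp: K_def)
    ultimately show ?thesis by (metis card_lessThan less_irrefl psubsetI)
  qed
  have proj_glue: "proj J (glue m B) = glue m (\<lambda>i. proj (K i) (B i))" for B
  proof
    fix l
    have "l mod m < m" "(l div m) * m + l mod m = l" using assms(1) by simp_all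
    thus "proj J (glue m B) l = glue m (\<lambda>i. proj (K i) (B i)) l"
      unfolding proj_def glue_def K_def by auto
  qed
  have gen: "map_pmf (proj J) (map_pmf (glue m) (Pi_pmf {..<m} (\<lambda>_. False) (\<lambda>_. S))) =
      map_pmf (glue m) (Pi_pmf {..<m} (\<lambda>_. False) (\<lambda>i. map_pmf (proj (K i)) S))" for S
  proof -
    have "Pi_pmf {..<m} (\<lambda>_. False) (\<lambda>i. map_pmf (proj (K i)) S) =
        map_pmf (\<lambda>B i. proj (K i) (B i)) (Pi_pmf {..<m} (\<lambda>_. False) (\<lambda>_. S))"
      by (rule Pi_pmf_map_dep) (auto simp: proj_def)
    thus ?thesis by (simp add: pmf.map_comp o_def proj_glue)
  qed
  have "map_pmf (proj J) (map_pmf (glue m) (Pi_pmf {..<m} (\<lambda>_. False) (\<lambda>_. R))) =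
      map_pmf (proj J) (map_pmf (glue m) (Pi_pmf {..<m} (\<lambda>_. False) (\<lambda>_. coins {..<m})))"
    using K by (simp only: gen R map_proj_coins[OF finite_lessThan psubset_imp_subset])
  also have "\<dots> = coins J"
    using J by (simp add: map_glue_coins map_proj_coins)
  finally show "map_pmf (proj J) (map_pmf (glue m) (Pi_pmf {..<m} (\<lambda>_. False) (\<lambda>_. R))) = coins J" .
qed (use assms(1) in \<open>auto simp: cube_def PiE_dflt_def glue_def\<close>)

subsection \<open>Majority of few-wise independent bits\<close>

text \<open>Normalized to variance 1 under fair coins when \<open>m > 0\<close>. The factor stands
  inside the sum so that powers and exponentials split into factors for single bits.\<close>

definition sgn_sum :: "nat \<Rightarrow> (nat \<Rightarrow> bool) \<Rightarrow> real" where
  "sgn_sum m x = (\<Sum>i<m. (if x i then 1 else -1) / sqrt (real m))"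

lemma sgn_sum_pos_iff:
  assumes "odd m"
  shows "sgn_sum m x > 0 \<longleftrightarrow> majority m x"
proof -
  have "(\<Sum>i<m. if x i then 1 else (-1::real)) = (\<Sum>i<m. 2 * (if x i then 1 else 0) - 1)"
    by (intro sum.cong) auto
  also have "\<dots> = 2 * real (card {i\<in>{..<m}. x i}) - real m"
    by (subst sum_subtractf, subst sum_distrib_left[symmetric], subst sum.inter_filter [symmetric]) simp_all
  finally have "sgn_sum m x = (2 * real (card {i. i < m \<and> x i}) - real m) / sqrt (real m)"
    by (simp add: sgn_sum_def flip: sum_divide_distrib)
  moreover have "m > 0" using assms by (simp add: odd_pos)
  ultimately show ?thesis
    by (auto simp: majority_def zero_less_divide_iff)
qed

text \<open>Expanding the power gives monomials indexed by maps \<open>f\<close> from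
  \<open>{..<l}\<close> to \<open>{..<m}\<close>. Each involves at most \<open>l\<close> distinct
  bits, so its expectation is the same for every distribution in the class.\<close>

lemma expectation_sgn_sum_power:
  assumes "Q \<in> kwise_distrs m t (1/2)" "l \<le> t"
  shows "measure_pmf.expectation Q (\<lambda>x. sgn_sum m x ^ l) =
     measure_pmf.expectation (coins {..<m}) (\<lambda>x. sgn_sum m x ^ l)"
proof -
  define s where "s = (\<lambda>b. (if b then 1 else -1) / sqrt (real m))"
  have pow: "sgn_sum m x ^ l = (\<Sum>f\<in>PiE {..<l} (\<lambda>_. {..<m}). \<Prod>k<l. s (x (f k)))" for x
  proof -
    have "sgn_sum m x ^ l = (\<Prod>k<l. \<Sum>i<m. s (x i))"
      by (simp add: sgn_sum_def s_def)
    also have "\<dots> = (\<Sum>f\<in>PiE {..<l} (\<lambda>_. {..<m}). \<Prod>k<l. s (x (f k)))"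
      by (rule prod_sum_PiE) auto
    finally show ?thesis .
  qed
  have fin: "finite (set_pmf R)" if "R \<in> kwise_distrs m t (1/2)" for R
    using that finite_subset[OF _ finite_cube] by (auto simp: kwise_distrs_def)
  have *: "measure_pmf.expectation R (\<lambda>x. \<Prod>k<l. s (x (f k))) =
      measure_pmf.expectation (coins (f ` {..<l})) (\<lambda>x. \<Prod>k<l. s (x (f k)))"
    if R: "R \<in> kwise_distrs m t (1/2)" and f: "f \<in> PiE {..<l} (\<lambda>_. {..<m})" for R f
  proof -
    have "f ` {..<l} \<subseteq> {..<m}" using f by auto
    moreover have "card (f ` {..<l}) \<le> t"
      using card_image_le[of "{..<l}" f] assms(2) by simp
    ultimately have "coins (f ` {..<l}) = map_pmf (proj (f ` {..<l})) R"
      using map_proj_kwise_distrs[OF R] by simp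
    thus ?thesis by (simp add: proj_def)
  qed
  have "measure_pmf.expectation R (\<lambda>x. sgn_sum m x ^ l) = (\<Sum>f\<in>PiE {..<l} (\<lambda>_. {..<m}).
      measure_pmf.expectation (coins (f ` {..<l})) (\<lambda>x. \<Prod>k<l. s (x (f k))))"
    if R: "R \<in> kwise_distrs m t (1/2)" for R
    unfolding pow using fin[OF R]
    by (subst Bochner_Integration.integral_sum) (auto intro!: integrable_measure_pmf_finite sum.cong *[OF R])
  from this[OF assms(1)] this[OF coins_kwise_distrs] show ?thesis by simp
qed

section \<open>Characteristic functions of the normalized sum of signs\<close>

definition sgn_law :: "nat \<Rightarrow> (nat \<Rightarrow> bool) pmf \<Rightarrow> real measure" where
  "sgn_law m Q = distr (measure_pmf Q) borel (sgn_sum m)"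

lemma real_distribution_sgn_law: "real_distribution (sgn_law m Q)"
  unfolding sgn_law_def
  by (rule prob_space.real_distribution_distr[OF measure_pmf.prob_space_axioms]) simp

lemma char_sgn_law_coins: "char (sgn_law m (coins {..<m})) u = complex_of_real (cos (u / sqrt (real m)) ^ m)"
proof -
  let ?C = "measure_pmf (coins {..<m})"
  define X where "X = (\<lambda>i (x :: nat \<Rightarrow> bool). (if x i then 1 else -1) / sqrt (real m))"
  have "prob_space.indep_vars ?C (\<lambda>_. count_space UNIV) (\<lambda>i x. x i) {..<m}"
    unfolding coins_def by (intro indep_vars_Pi_pmf) simp
  hence "prob_space.indep_vars ?C (\<lambda>_. borel) X {..<m}"
    unfolding X_def
    by (rule prob_space.indep_vars_compose2[OF measure_pmf.prob_space_axioms]) auto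
  hence "char (sgn_law m (coins {..<m})) u = (\<Prod>i<m. char (distr ?C borel (X i)) u)"
    using prob_space.char_distr_sum[OF measure_pmf.prob_space_axioms, of "coins {..<m}" X "{..<m}" u]
    unfolding sgn_law_def sgn_sum_def[abs_def] X_def by simp
  also have "\<dots> = (\<Prod>i<m. complex_of_real (cos (u / sqrt (real m))))"
  proof (intro prod.cong refl)
    fix i assume i: "i \<in> {..<m}"
    have "char (distr ?C borel (X i)) u = (CLINT x|?C. iexp (u * X i x))"
      unfolding char_def by (subst integral_distr) auto
    also have "\<dots> = (CLINT b|measure_pmf (map_pmf (\<lambda>x. x i) (coins {..<m})).
        iexp (u * ((if b then 1 else -1) / sqrt (real m))))"
      by (simp add: X_def)
    also have "map_pmf (\<lambda>x. x i) (coins {..<m}) = bernoulli_pmf (1/2)"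
      using i by (simp add: coins_def Pi_pmf_component)
    also have "(CLINT b|measure_pmf (bernoulli_pmf (1/2)).
        iexp (u * ((if b then 1 else -1) / sqrt (real m)))) = complex_of_real (cos (u / sqrt (real m)))"
      by (subst integral_measure_pmf[where A = UNIV])
        (auto simp: UNIV_bool complex_eq_iff Re_exp Im_exp)
    finally show "char (distr ?C borel (X i)) u = complex_of_real (cos (u / sqrt (real m)))" .
  qed
  finally show ?thesis by simp
qed

text \<open>The moment generating function; it serves to bound the Taylor remainder uniformly in
  \<open>m\<close>.\<close>

lemma expectation_exp_sgn_sum_coins:
  "measure_pmf.expectation (coins {..<m}) (\<lambda>x. exp (a * sgn_sum m x)) = cosh (a / sqrt (real m)) ^ m"
proof -
  have "measure_pmf.expectation (coins {..<m}) (\<lambda>x. exp (a * sgn_sum m x)) =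
      measure_pmf.expectation (coins {..<m}) (\<lambda>x. \<Prod>i<m. exp (a * ((if x i then 1 else -1) / sqrt (real m))))"
    by (simp add: sgn_sum_def sum_distrib_left exp_sum)
  also have "\<dots> = (\<Prod>i<m. measure_pmf.expectation (bernoulli_pmf (1/2))
      (\<lambda>b. exp (a * ((if b then 1 else -1) / sqrt (real m)))))"
    unfolding coins_def by (rule expectation_prod_Pi_pmf) (auto intro!: integrable_measure_pmf_finite)
  also have "measure_pmf.expectation (bernoulli_pmf (1/2))
      (\<lambda>b. exp (a * ((if b then 1 else -1) / sqrt (real m)))) = cosh (a / sqrt (real m))"
    by (simp add: cosh_def field_simps)
  finally show ?thesis by simp
qed

lemma power_div_fact_le_exp:
  fixes y :: real
  assumes "0 \<le> y"
  shows "y ^ n / fact n \<le> exp y"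
proof -
  have "(\<Sum>k\<in>{n}. y ^ k /\<^sub>R fact k) \<le> (\<Sum>k. y ^ k /\<^sub>R fact k)"
    using assms by (intro sum_le_suminf summable_exp_generic) auto
  thus ?thesis by (simp add: exp_def divide_inverse mult.commute)
qed

text \<open>With \<open>char_sgn_law_coins\<close> this is the central limit theorem for fair signs
  on the level of characteristic functions; odd \<open>m\<close> is written as
  \<open>2 * j + 1\<close>.\<close>

lemma tendsto_cos_power:
  "(\<lambda>j. cos (u / sqrt (real (2 * j + 1))) ^ (2 * j + 1)) \<longlonglongrightarrow> exp (- u\<^sup>2 / 2)"
  by real_asymp (simp add: powr_half_sqrt power2_eq_square field_simps)

lemma tendsto_cosh_power:
  "(\<lambda>j. cosh (a / sqrt (real (2 * j + 1))) ^ (2 * j + 1)) \<longlonglongrightarrow> exp (a\<^sup>2 / 2)"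
  unfolding cosh_field_def by real_asymp (simp add: powr_half_sqrt power2_eq_square field_simps)


text \<open>Equal moments up to \<open>T\<close> give both characteristic functions the same Taylor
  polynomial \<open>c\<close>. For even \<open>T\<close> the remainder involves the plain moment of
  order \<open>T\<close>, which is again the one of fair coins.\<close>

lemma sgn_law_char_diff:
  assumes Q: "Q \<in> kwise_distrs m t (1/2)" and T: "even T" "T \<le> t"
  shows "cmod (char (sgn_law m Q) u - char (sgn_law m (coins {..<m})) u) \<le>
     8 * (1/2) ^ T * cosh (2 * u / sqrt (real m)) ^ m"
proof -
  let ?E = "\<lambda>l. measure_pmf.expectation (coins {..<m}) (\<lambda>x. sgn_sum m x ^ l)"
  have fin: "integrable (measure_pmf R) g" if "R \<in> kwise_distrs m t (1/2)"
    for R and g :: "(nat \<Rightarrow> bool) \<Rightarrow> real"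
    using that finite_subset[OF _ finite_cube]
    by (intro integrable_measure_pmf_finite) (auto simp: kwise_distrs_def)
  define c where "c = (\<Sum>k\<le>T. ((\<i> * u)^k / fact k) * ?E k)"
  have approx: "cmod (char (sgn_law m R) u - c) \<le> (2 * \<bar>u\<bar> ^ T / fact T) * ?E T"
    if R: "R \<in> kwise_distrs m t (1/2)" for R
  proof -
    have int: "integrable (sgn_law m R) (\<lambda>x. x ^ k)" for k
      unfolding sgn_law_def using fin[OF R] by (subst integrable_distr_eq) auto
    have mom: "integral\<^sup>L (sgn_law m R) (\<lambda>x. x ^ k) = ?E k" if "k \<le> T" for k
      using expectation_sgn_sum_power[OF R, of k] that T(2)
      by (simp add: sgn_law_def integral_distr)
    have "cmod (char (sgn_law m R) u -
        (\<Sum>k\<le>T. ((\<i> * u)^k / fact k) * integral\<^sup>L (sgn_law m R) (\<lambda>x. x ^ k))) \<le>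
        (2 * \<bar>u\<bar> ^ T / fact T) * integral\<^sup>L (sgn_law m R) (\<lambda>x. \<bar>x\<bar> ^ T)"
      by (rule real_distribution.char_approx1[OF real_distribution_sgn_law int])
    also have "(\<Sum>k\<le>T. ((\<i> * u)^k / fact k) * integral\<^sup>L (sgn_law m R) (\<lambda>x. x ^ k)) = c"
      unfolding c_def by (intro sum.cong refl) (simp add: mom)
    also have "integral\<^sup>L (sgn_law m R) (\<lambda>x. \<bar>x\<bar> ^ T) = ?E T"
      using T(1) mom[of T] by (simp add: power_even_abs)
    finally show ?thesis .
  qed
  \<comment> \<open>Apply \<open>y ^ T / fact T \<le> exp y\<close> to the absolute value of
    \<open>2 * u * sgn_sum m x\<close>: the doubling is compensated by the factor
    \<open>(1/2) ^ T\<close>, which later drives the error to 0.\<close>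
  have "\<bar>u\<bar> ^ T / fact T * sgn_sum m x ^ T \<le>
      (1/2) ^ T * (exp (2 * u * sgn_sum m x) + exp (- (2 * u) * sgn_sum m x))" for x
  proof -
    have "\<bar>u\<bar> ^ T / fact T * sgn_sum m x ^ T = (1/2) ^ T * (\<bar>2 * u * sgn_sum m x\<bar> ^ T / fact T)"
      using T(1) by (simp add: power_mult_distrib power_even_abs field_simps)
    also have "\<dots> \<le> (1/2) ^ T * exp \<bar>2 * u * sgn_sum m x\<bar>"
      by (intro mult_left_mono power_div_fact_le_exp) auto
    also have "\<dots> \<le> (1/2) ^ T * (exp (2 * u * sgn_sum m x) + exp (- (2 * u) * sgn_sum m x))"
      by (intro mult_left_mono) (auto simp: abs_if)
    finally show ?thesis .
  qed
  hence "measure_pmf.expectation (coins {..<m}) (\<lambda>x. \<bar>u\<bar> ^ T / fact T * sgn_sum m x ^ T) \<le>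
      measure_pmf.expectation (coins {..<m})
        (\<lambda>x. (1/2) ^ T * (exp (2 * u * sgn_sum m x) + exp (- (2 * u) * sgn_sum m x)))"
    by (intro integral_mono fin coins_kwise_distrs)
  also have "\<dots> = (1/2) ^ T * (2 * cosh (2 * u / sqrt (real m)) ^ m)"
    using expectation_exp_sgn_sum_coins[of m "2 * u"] expectation_exp_sgn_sum_coins[of m "- (2 * u)"]
    by (simp add: Bochner_Integration.integral_add fin[OF coins_kwise_distrs])
  finally have "(2 * \<bar>u\<bar> ^ T / fact T) * ?E T \<le> 4 * (1/2) ^ T * cosh (2 * u / sqrt (real m)) ^ m"
    by simp
  \<comment> \<open>Each of the two characteristic functions has distance at most 4 times the common
    factor from \<open>c\<close>; hence the constant 8.\<close>
  with approx[OF Q] approx[OF coins_kwise_distrs] show ?thesis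
    using norm_triangle_ineq4[of "char (sgn_law m Q) u - c" "char (sgn_law m (coins {..<m})) u - c"]
    by simp
qed

section \<open>Convergence to the normal law\<close>

lemma isCont_cdf_std_normal: "isCont (cdf std_normal_distribution) x"
proof -
  interpret real_distribution std_normal_distribution by (rule real_dist_normal_dist)
  have "{x} \<in> null_sets lborel"
    by (simp add: null_sets_def)
  hence "{x} \<in> null_sets std_normal_distribution"
    using absolutely_continuousI_density[of std_normal_density lborel]
    by (auto simp: absolutely_continuous_def)
  hence "measure std_normal_distribution {x} = 0"
    by (simp add: measure_eq_0_null_sets)
  thus ?thesis by (simp add: isCont_cdf)
qed

lemma weak_conv_sgn_law:
  assumes Q: "\<And>j. Q j \<in> kwise_distrs (2 * j + 1) (t j) (1/2)"
    and t: "filterlim t at_top sequentially"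
  shows "weak_conv_m (\<lambda>j. sgn_law (2 * j + 1) (Q j)) std_normal_distribution"
proof (rule levy_continuity[OF real_distribution_sgn_law real_dist_normal_dist])
  fix u :: real
  \<comment> \<open>The largest even number up to \<open>t j\<close>, since the remainder estimate
    needs an even order.\<close>
  define T where "T = (\<lambda>j. 2 * (t j div 2))"
  have "filterlim T at_top sequentially"
  proof (rule filterlim_at_top_mono[where f = "\<lambda>j. t j - 1"])
    show "filterlim (\<lambda>j. t j - 1) at_top sequentially"
      using t by (rule filterlim_compose[OF filterlim_minus_const_nat_at_top])
    show "\<forall>\<^sub>F j in sequentially. t j - 1 \<le> T j"
      unfolding T_def by (intro always_eventually allI) presburger
  qed
  hence "(\<lambda>j. (1/2 :: real) ^ T j) \<longlonglongrightarrow> 0"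
    by (rule filterlim_compose[OF LIMSEQ_realpow_zero[of "1/2"], rotated 2]) auto
  \<comment> \<open>The \<open>cosh\<close> factor has a finite limit for fixed \<open>u\<close>, so
    the bound vanishes however slowly \<open>t\<close> grows.\<close>
  from tendsto_mult[OF tendsto_mult[OF tendsto_const[of 8] this] tendsto_cosh_power[of "2 * u"]]
  have "(\<lambda>j. 8 * (1/2) ^ T j * cosh (2 * u / sqrt (real (2 * j + 1))) ^ (2 * j + 1)) \<longlonglongrightarrow> 0"
    by simp
  hence "(\<lambda>j. char (sgn_law (2 * j + 1) (Q j)) u -
      char (sgn_law (2 * j + 1) (coins {..<2 * j + 1})) u) \<longlonglongrightarrow> 0"
  proof (rule Lim_null_comparison[OF always_eventually, OF allI, rotated])
    fix j
    show "cmod (char (sgn_law (2 * j + 1) (Q j)) u - char (sgn_law (2 * j + 1) (coins {..<2 * j + 1})) u) \<le>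
      8 * (1/2) ^ T j * cosh (2 * u / sqrt (real (2 * j + 1))) ^ (2 * j + 1)"
      by (rule sgn_law_char_diff[OF Q]) (auto simp: T_def)
  qed
  moreover have "(\<lambda>j. char (sgn_law (2 * j + 1) (coins {..<2 * j + 1})) u) \<longlonglongrightarrow> char std_normal_distribution u"
    unfolding char_sgn_law_coins char_std_normal_distribution
    by (intro tendsto_of_real tendsto_cos_power)
  ultimately show "(\<lambda>j. char (sgn_law (2 * j + 1) (Q j)) u) \<longlonglongrightarrow> char std_normal_distribution u"
    by (rule Lim_transform[rotated])
qed

lemma cdf_sgn_law_0:
  assumes "odd m"
  shows "cdf (sgn_law m Q) 0 = 1 - measure_pmf.prob Q {x. majority m x}"
proof -
  have "cdf (sgn_law m Q) 0 = measure_pmf.prob Q {x. \<not> sgn_sum m x > 0}"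
    unfolding cdf_def2 sgn_law_def by (subst measure_distr) (auto simp: vimage_def not_less)
  also have "\<dots> = measure_pmf.prob Q (UNIV - {x. majority m x})"
    by (rule arg_cong[where f = "measure_pmf.prob Q"]) (auto simp: sgn_sum_pos_iff[OF assms])
  also have "\<dots> = 1 - measure_pmf.prob Q {x. majority m x}"
    using measure_pmf.prob_compl[of "{x. majority m x}" Q] by simp
  finally show ?thesis .
qed

lemma tendsto_prob_majority:
  assumes Q: "\<And>j. Q j \<in> kwise_distrs (2 * j + 1) (t j) (1/2)"
    and t: "filterlim t at_top sequentially"
  shows "(\<lambda>j. measure_pmf.prob (Q j) {x. majority (2 * j + 1) x}) \<longlonglongrightarrow> 1/2"
proof -
  have lim: "(\<lambda>j. 1 - measure_pmf.prob (R j) {x. majority (2 * j + 1) x})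
      \<longlonglongrightarrow> cdf std_normal_distribution 0"
    if "\<And>j. R j \<in> kwise_distrs (2 * j + 1) (t j) (1/2)" for R
  proof -
    have "(\<lambda>j. cdf (sgn_law (2 * j + 1) (R j)) 0) \<longlonglongrightarrow> cdf std_normal_distribution 0"
      using weak_conv_sgn_law[OF that t] isCont_cdf_std_normal[of 0]
      unfolding weak_conv_m_def weak_conv_def by blast
    moreover have odd: "odd (2 * j + 1)" for j :: nat by simp
    ultimately show ?thesis by (simp only: cdf_sgn_law_0[OF odd])
  qed
  txt \<open>The fully independent case gives the value of the limit without computing it.\<close>
  have "(\<lambda>j. 1 / 2 :: real) \<longlonglongrightarrow> cdf std_normal_distribution 0"
    using lim[OF coins_kwise_distrs] by (simp add: prob_coins_majority)
  hence "cdf std_normal_distribution 0 = 1/2"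
    using LIMSEQ_unique tendsto_const by blast
  with tendsto_diff[OF tendsto_const[of 1] lim[OF Q]] show ?thesis by simp
qed

subsection \<open>Blocks of fixed parity\<close>

definition parity_class :: "nat \<Rightarrow> bool \<Rightarrow> (nat \<Rightarrow> bool) set" where
  "parity_class m e = {b \<in> PiE_dflt {..<m} False (\<lambda>_. UNIV). even (card {i. i < m \<and> b i}) = e}"

text \<open>Before and after the flip the set of ones is \<open>S\<close> or
  \<open>insert a S\<close>, where \<open>S\<close> collects the ones away from \<open>a\<close>,
  and exactly one of the two contains \<open>a\<close>.\<close>

lemma even_card_fun_upd_Not:
  fixes a m :: nat
  assumes "a < m"
  shows "even (card {i. i < m \<and> (b(a := \<not> b a)) i}) \<longleftrightarrow> odd (card {i. i < m \<and> b i})"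
proof -
  define S where "S = {i. i < m \<and> i \<noteq> a \<and> b i}"
  have "finite S" by (rule finite_subset[of _ "{..<m}"]) (auto simp: S_def)
  moreover have "a \<notin> S" by (simp add: S_def)
  ultimately have S: "finite S" "a \<notin> S" by simp_all
  have *: "{i. i < m \<and> c i} = (if c a then insert a S else S)"
    if "\<And>i. i \<noteq> a \<Longrightarrow> c i = b i" for c
    using that assms by (auto simp: S_def) metis+
  show ?thesis
    using *[of b] *[of "b(a := \<not> b a)"] S by auto
qed

lemma bij_betw_flip_parity_class:
  assumes "a < m"
  shows "bij_betw (\<lambda>b. b(a := \<not> b a)) (parity_class m e) (parity_class m (\<not> e))"
proof (rule bij_betwI[where g = "\<lambda>b. b(a := \<not> b a)"])
  have "b(a := \<not> b a) \<in> parity_class m (\<not> e)" if "b \<in> parity_class m e" for b e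
    using that assms even_card_fun_upd_Not[OF assms, of b]
    by (auto simp: parity_class_def PiE_dflt_def)
  from this[of _ e] this[of _ "\<not> e"]
  show "(\<lambda>b. b(a := \<not> b a)) \<in> parity_class m e \<rightarrow> parity_class m (\<not> e)"
    "(\<lambda>b. b(a := \<not> b a)) \<in> parity_class m (\<not> e) \<rightarrow> parity_class m e" by auto
qed auto

lemma parity_class_Un:
  "parity_class m e \<union> parity_class m (\<not> e) = PiE_dflt {..<m} False (\<lambda>_. UNIV)"
  "parity_class m e \<inter> parity_class m (\<not> e) = {}"
  by (auto simp: parity_class_def)

lemma finite_parity_class [simp]: "finite (parity_class m e)"
  by (rule finite_subset[of _ "PiE_dflt {..<m} False (\<lambda>_. UNIV)"]) (auto simp: parity_class_def)

lemma parity_class_nonempty: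
  assumes "0 < m"
  shows "parity_class m e \<noteq> {}"
proof
  assume "parity_class m e = {}"
  \<comment> \<open>The flip would empty the other class too, but the zero vector lies in one of
    them.\<close>
  moreover from this have "parity_class m (\<not> e) = {}"
    using bij_betw_flip_parity_class[OF assms, of e] by (auto simp: bij_betw_def)
  moreover have "(\<lambda>_. False) \<in> PiE_dflt {..<m} False (\<lambda>_. UNIV)"
    by (simp add: PiE_dflt_def)
  ultimately show False
    using parity_class_Un(1)[of m e] by blast
qed

lemma map_proj_parity_class:
  assumes "J \<subset> {..<m}"
  shows "map_pmf (proj J) (pmf_of_set (parity_class m e)) = coins J"
proof -
  txt \<open>Flipping a bit outside \<open>J\<close> exchanges the two parity classes and is not visible on \<open>J\<close>.\<close>
  obtain a where a: "a < m" "a \<notin> J" using assms by auto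
  have ne: "parity_class m e \<noteq> {}" for e
    using a by (intro parity_class_nonempty) simp
  let ?R = "\<lambda>e. pmf_of_set (parity_class m e)"
  have "map_pmf (proj J) (?R (\<not> e)) = map_pmf (proj J) (map_pmf (\<lambda>b. b(a := \<not> b a)) (?R e))"
    by (simp add: map_pmf_of_set_bij_betw[OF bij_betw_flip_parity_class[OF a(1)] ne])
  also have "\<dots> = map_pmf (proj J) (?R e)"
    using a(2) by (auto simp: pmf.map_comp proj_def fun_eq_iff intro!: map_pmf_cong)
  finally have eq: "map_pmf (proj J) (?R (\<not> e)) = map_pmf (proj J) (?R e)" .
  have card: "card (parity_class m (\<not> e)) = card (parity_class m e)"
    using bij_betw_same_card[OF bij_betw_flip_parity_class[OF a(1), of e]] by simp
  have pos: "card (parity_class m e) > 0"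
    using ne[of e] by (simp add: card_gt_0_iff)
  \<comment> \<open>Fair coins are the equal mixture of the two parity classes. As both have the
    same projection, each projection equals that of the mixture.\<close>
  have split: "measure_pmf.prob (coins {..<m}) A =
      (measure_pmf.prob (?R e) A + measure_pmf.prob (?R (\<not> e)) A) / 2" for A
  proof -
    have "card (PiE_dflt {..<m} False (\<lambda>_. UNIV :: bool set)) = 2 * card (parity_class m e)"
      unfolding parity_class_Un(1)[of m e, symmetric]
      by (subst card_Un_disjoint) (auto simp: parity_class_Un card)
    moreover have "card (PiE_dflt {..<m} False (\<lambda>_. UNIV :: bool set) \<inter> A) =
        card (parity_class m e \<inter> A) + card (parity_class m (\<not> e) \<inter> A)"
      unfolding parity_class_Un(1)[of m e, symmetric] Int_Un_distrib2
      using parity_class_Un(2)[of m e] by (subst card_Un_disjoint) auto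
    moreover have "finite (PiE_dflt {..<m} False (\<lambda>_. UNIV :: bool set))"
      by (intro finite_PiE_dflt) auto
    ultimately show ?thesis
      using ne pos by (simp add: coins_eq_pmf_of_set measure_pmf_of_set card field_simps)
  qed
  have "map_pmf (proj J) (?R e) = map_pmf (proj J) (coins {..<m})"
  proof (rule pmf_eqI)
    fix v
    have "pmf (map_pmf (proj J) (coins {..<m})) v =
        (pmf (map_pmf (proj J) (?R e)) v + pmf (map_pmf (proj J) (?R (\<not> e))) v) / 2"
      by (simp only: pmf_map split)
    thus "pmf (map_pmf (proj J) (?R e)) v = pmf (map_pmf (proj J) (coins {..<m})) v"
      by (simp add: eq)
  qed
  thus ?thesis using assms by (simp add: map_proj_coins psubset_imp_subset)
qed

text \<open>By negation, at least \<open>h\<close> ones and at most \<open>h\<close> ones are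
  equally likely. The two events cover everything and overlap in exactly \<open>h\<close> ones, so
  twice the probability is 1 plus the central binomial weight.\<close>

lemma binomial_half_upper_tail:
  "measure_pmf.prob (coins {..<2 * h}) {b. h \<le> card {i. i < 2 * h \<and> b i}} =
     1/2 + real ((2 * h) choose h) / 4 ^ h / 2"
proof -
  let ?U = "measure_pmf.prob (coins {..<2 * h})" and ?c = "\<lambda>b. card {i. i < 2 * h \<and> b i}"
  have compl: "?c b + ?c (\<lambda>i. \<not> b i) = 2 * h" for b
  proof -
    have "?c b + ?c (\<lambda>i. \<not> b i) = card {..<2 * h}"
      by (subst card_Un_disjoint [symmetric]) (auto intro!: arg_cong[where f = card] simp del: card_lessThan)
    thus ?thesis by simp
  qed
  have "?U {b. h \<le> ?c b} =
      measure_pmf.prob (map_pmf (\<lambda>x. proj {..<2 * h} (\<lambda>i. \<not> x i)) (coins {..<2 * h})) {b. h \<le> ?c b}"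
    by (simp only: map_Not_coins finite_lessThan)
  also have "\<dots> = ?U {b. h \<le> ?c (\<lambda>i. \<not> b i)}"
    by (simp add: vimage_def proj_def cong: conj_cong)
  also have "{b. h \<le> ?c (\<lambda>i. \<not> b i)} = {b. ?c b \<le> h}"
  proof -
    have "h \<le> ?c (\<lambda>i. \<not> b i) \<longleftrightarrow> ?c b \<le> h" for b using compl[of b] by linarith
    thus ?thesis by blast
  qed
  finally have sym: "?U {b. h \<le> ?c b} = ?U {b. ?c b \<le> h}" .
  have "?U {b. h \<le> ?c b} + ?U {b. ?c b \<le> h} = ?U ({b. h \<le> ?c b} \<union> {b. ?c b \<le> h}) +
      ?U ({b. h \<le> ?c b} \<inter> {b. ?c b \<le> h})"
    by (subst measure_Un3) (simp_all add: measure_pmf.fmeasurable_eq_sets)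
  also have "{b. h \<le> ?c b} \<union> {b. ?c b \<le> h} = UNIV" by auto
  also have "{b. h \<le> ?c b} \<inter> {b. ?c b \<le> h} = {b. ?c b = h}" by auto
  also have "?U {b. ?c b = h} = pmf (map_pmf (\<lambda>b. card {i\<in>{..<2 * h}. b i}) (coins {..<2 * h})) h"
    by (simp add: pmf_map vimage_def)
  also have "map_pmf (\<lambda>b. card {i\<in>{..<2 * h}. b i}) (coins {..<2 * h}) = binomial_pmf (2 * h) (1/2)"
    unfolding coins_def by (rule binomial_pmf_altdef'[symmetric]) auto
  also have "pmf \<dots> h = real ((2 * h) choose h) / 4 ^ h"
  proof -
    have "(1/2 :: real) ^ h * (1/2) ^ h = (1/4) ^ h"
      by (simp only: power_mult_distrib[symmetric]) simp
    thus ?thesis by (simp add: power_one_over mult.assoc)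
  qed
  finally show ?thesis using sym by (simp add: measure_pmf.prob_space[simplified])
qed

text \<open>Given the first \<open>2 * h\<close> bits, the parity of the number of ones fixes the last bit. For the
  parity of \<open>h + 1\<close>, the majority holds iff at least \<open>h\<close> of the first \<open>2 * h\<close> bits are ones.\<close>

lemma prob_majority_parity_class:
  assumes m_def: "m = 2 * h + 1"
  shows "measure_pmf.prob (pmf_of_set (parity_class m (even (h + 1)))) {b. majority m b} =
     1/2 + real ((2 * h) choose h) / 4 ^ h / 2"
proof -
  let ?R = "pmf_of_set (parity_class m (even (h + 1)))"
  have ne: "parity_class m (even (h + 1)) \<noteq> {}"
    by (rule parity_class_nonempty) (simp add: m_def)
  have eq: "majority m b \<longleftrightarrow> h \<le> card {i. i < 2 * h \<and> proj {..<2 * h} b i}"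
    if "b \<in> parity_class m (even (h + 1))" for b
  proof -
    have "{i. i < m \<and> b i} = (if b (2 * h) then insert (2 * h) {i. i < 2 * h \<and> b i} else {i. i < 2 * h \<and> b i})"
      by (auto simp: m_def less_Suc_eq)
    hence "card {i. i < m \<and> b i} = card {i. i < 2 * h \<and> b i} + of_bool (b (2 * h))"
      by simp
    moreover have "even (card {i. i < m \<and> b i}) = even (h + 1)"
      using that by (simp add: parity_class_def)
    ultimately show ?thesis
      unfolding majority_def m_def
      by (cases "card {i. i < 2 * h \<and> b i} = h"; cases "b (2 * h)") (auto simp: proj_def cong: conj_cong)
  qed
  have "measure_pmf.prob ?R {b. majority m b} =
      measure_pmf.prob ?R {b. h \<le> card {i. i < 2 * h \<and> proj {..<2 * h} b i}}"
    using ne eq by (intro measure_pmf.finite_measure_eq_AE) (auto simp: AE_measure_pmf_iff)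
  also have "\<dots> = measure_pmf.prob (map_pmf (proj {..<2 * h}) ?R) {b. h \<le> card {i. i < 2 * h \<and> b i}}"
    by (simp add: vimage_def)
  \<comment> \<open>Omitting the last position leaves a proper subset, so the parity constraint is
    invisible.\<close>
  also have "map_pmf (proj {..<2 * h}) ?R = coins {..<2 * h}"
    by (rule map_proj_parity_class) (auto simp: m_def)
  finally show ?thesis by (simp only: binomial_half_upper_tail)
qed

subsection \<open>Majority of slightly biased bits\<close>

lemma prob_majority_bernoulli:
  assumes "0 \<le> p" "p \<le> 1"
  shows "measure_pmf.prob (Pi_pmf {..<2 * h + 1} False (\<lambda>_. bernoulli_pmf p)) {b. majority (2 * h + 1) b} =
     (\<Sum>j=h+1..2*h+1. real ((2 * h + 1) choose j) * p ^ j * (1 - p) ^ (2 * h + 1 - j))"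
proof -
  let ?m = "2 * h + 1"
  have "measure_pmf.prob (Pi_pmf {..<?m} False (\<lambda>_. bernoulli_pmf p)) {b. majority ?m b} =
      measure_pmf.prob (map_pmf (\<lambda>b. card {i\<in>{..<?m}. b i}) (Pi_pmf {..<?m} False (\<lambda>_. bernoulli_pmf p)))
        {j. ?m < 2 * j}"
    by (simp add: vimage_def majority_def)
  also have "map_pmf (\<lambda>b. card {i\<in>{..<?m}. b i}) (Pi_pmf {..<?m} False (\<lambda>_. bernoulli_pmf p)) =
      binomial_pmf ?m p"
    using assms by (intro binomial_pmf_altdef'[symmetric]) auto
  also have "measure_pmf.prob (binomial_pmf ?m p) {j. ?m < 2 * j} =
      measure_pmf.prob (binomial_pmf ?m p) {h+1..?m}"
    using assms by (intro measure_pmf.finite_measure_eq_AE)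
      (auto simp: AE_measure_pmf_iff set_pmf_binomial_eq split: if_splits)
  also have "\<dots> = (\<Sum>j=h+1..?m. real (?m choose j) * p ^ j * (1 - p) ^ (?m - j))"
    using assms by (subst measure_measure_pmf_finite) auto
  finally show ?thesis .
qed

text \<open>The derivatives of the summands telescope. What remains is the number of bits times the
  probability that the other \<open>2 * h\<close> bits are tied, that is, that a given bit is
  pivotal.\<close>

lemma binomial_tail_deriv:
  "((\<lambda>p. \<Sum>j=h+1..2*h+1. real ((2 * h + 1) choose j) * p ^ j * (1 - p) ^ (2 * h + 1 - j))
     has_real_derivative real (2 * h + 1) * real ((2 * h) choose h) * (p * (1 - p)) ^ h) (at p)"
proof -
  \<comment> \<open>For \<open>p\<close> in the unit interval, \<open>2 * h + 1\<close> times the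
    probability of \<open>j\<close> ones among \<open>2 * h\<close> bits. It vanishes at
    \<open>j = 2 * h + 1\<close>, so only \<open>T h\<close> survives the telescoping.\<close>
  define T where "T = (\<lambda>j. real (2 * h + 1) * real ((2 * h) choose j) * p ^ j * (1 - p) ^ (2 * h - j))"
  have term_deriv: "((\<lambda>p. real ((2 * h + 1) choose Suc i) * p ^ Suc i * (1 - p) ^ (2 * h + 1 - Suc i))
      has_real_derivative T i - T (Suc i)) (at p)" if "i \<le> 2 * h" for i
  proof -
    have c1: "real (Suc i) * real ((2 * h + 1) choose Suc i) = real (2 * h + 1) * real ((2 * h) choose i)"
      using Suc_times_binomial_eq[of "2 * h" i] by (simp only: of_nat_mult [symmetric] mult.commute Suc_eq_plus1)
    have c2: "real (2 * h - i) * real ((2 * h + 1) choose Suc i) =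
        real (2 * h + 1) * real ((2 * h) choose Suc i)"
    proof -
      have "(2 * h - i) * ((2 * h + 1) choose Suc i) = (2 * h + 1) * ((2 * h) choose Suc i)"
        using binomial_absorb_comp[of "2 * h + 1" "Suc i"] by (simp del: binomial_Suc_Suc)
      thus ?thesis by (simp only: of_nat_mult [symmetric])
    qed
    have "((\<lambda>p. real ((2 * h + 1) choose Suc i) * p ^ Suc i * (1 - p) ^ (2 * h - i))
      has_real_derivative (real (Suc i) * real ((2 * h + 1) choose Suc i)) * p ^ i * (1 - p) ^ (2 * h - i) -
        (real (2 * h - i) * real ((2 * h + 1) choose Suc i)) * p ^ Suc i * (1 - p) ^ (2 * h - Suc i)) (at p)"
      by (rule derivative_eq_intros refl | simp add: algebra_simps)+
    thus ?thesis unfolding c1 c2 T_def by simp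
  qed
  have "((\<lambda>p. \<Sum>i=h..2*h. real ((2 * h + 1) choose Suc i) * p ^ Suc i * (1 - p) ^ (2 * h + 1 - Suc i))
      has_real_derivative (\<Sum>i=h..2*h. T i - T (Suc i))) (at p)"
    by (intro DERIV_sum term_deriv) auto
  also have "(\<Sum>i=h..2*h. T i - T (Suc i)) = T h - T (Suc (2 * h))"
    using sum_Suc_diff[of h "2 * h" "\<lambda>i. - T i"] by simp
  also have "\<dots> = real (2 * h + 1) * real ((2 * h) choose h) * (p * (1 - p)) ^ h"
    by (simp add: T_def power_mult_distrib)
  finally show ?thesis
    by (simp only: sum.shift_bounds_cl_Suc_ivl Suc_eq_plus1[symmetric])
qed

text \<open>Squaring avoids roots and lets both bounds pass through an induction on the ratio of
  consecutive terms. The steps reduce to \<open>4 * h * (h + 1) \<le> (2 * h + 1)\<^sup>2\<close>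
  and \<open>(2 * h + 1) * (2 * h + 3) \<le> (2 * h + 2)\<^sup>2\<close>.\<close>

lemma central_binomial_bounds:
  assumes "1 \<le> h"
  shows "1 / (4 * real h) \<le> (real ((2 * h) choose h) / 4 ^ h)\<^sup>2"
    and "(real ((2 * h) choose h) / 4 ^ h)\<^sup>2 \<le> 1 / (2 * real h + 1)"
proof -
  define b where "b = (\<lambda>h. real ((2 * h) choose h) / 4 ^ h)"
  have step: "b (Suc h) = b h * ((2 * real h + 1) / (2 * real h + 2))" for h
  proof -
    have "Suc h * ((2 * Suc h) choose Suc h) = 2 * (2 * h + 1) * ((2 * h) choose h)"
      using Suc_times_binomial_eq[of "Suc (2 * h)" h] Suc_times_binomial_eq[of "2 * h" h]
        binomial_symmetric[of h "Suc (2 * h)"]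
      by (simp add: algebra_simps)
    hence "real (Suc h) * real ((2 * Suc h) choose Suc h) = 2 * (2 * real h + 1) * real ((2 * h) choose h)"
      by (metis (mono_tags, opaque_lifting) of_nat_1 of_nat_add of_nat_mult of_nat_numeral)
    hence "real ((2 * Suc h) choose Suc h) = 2 * (2 * real h + 1) * real ((2 * h) choose h) / (real h + 1)"
      by (simp only: eq_divide_eq of_nat_Suc) (simp add: mult.commute add.commute del: binomial_Suc_Suc)
    moreover have "2 * u * C / y / (4 * D) = C / D * (u / (2 * y))" for u y C D :: real
      by (simp add: field_simps)
    moreover have "2 * real h + 2 = 2 * (real h + 1)" by simp
    ultimately show ?thesis by (simp only: b_def power_Suc)
  qed
  have "1 / (4 * real h) \<le> (b h)\<^sup>2 \<and> (b h)\<^sup>2 \<le> 1 / (2 * real h + 1)"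
    using assms
  proof (induction h rule: nat_induct_at_least)
    case base
    show ?case by (simp add: b_def power2_eq_square)
  next
    case (Suc h)
    let ?q = "((2 * real h + 1) / (2 * real h + 2))\<^sup>2"
    have h: "real h \<ge> 1" using Suc by simp
    have sq: "(b (Suc h))\<^sup>2 = (b h)\<^sup>2 * ?q"
      by (simp only: step power_mult_distrib)
    have "1 / (4 * real (Suc h)) \<le> 1 / (4 * real h) * ?q"
      using h by (simp add: divide_simps power2_eq_square) (simp add: algebra_simps)
    also have "\<dots> \<le> (b h)\<^sup>2 * ?q"
      using Suc by (intro mult_right_mono) auto
    finally have 1: "1 / (4 * real (Suc h)) \<le> (b (Suc h))\<^sup>2" unfolding sq .
    have "(b h)\<^sup>2 * ?q \<le> 1 / (2 * real h + 1) * ?q"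
      using Suc by (intro mult_right_mono) auto
    also have "\<dots> \<le> 1 / (2 * real (Suc h) + 1)"
      using h by (simp add: divide_simps power2_eq_square) (simp add: algebra_simps)
    finally have "(b (Suc h))\<^sup>2 \<le> 1 / (2 * real (Suc h) + 1)" unfolding sq .
    with 1 show ?case by blast
  qed
  thus "1 / (4 * real h) \<le> (real ((2 * h) choose h) / 4 ^ h)\<^sup>2"
    "(real ((2 * h) choose h) / 4 ^ h)\<^sup>2 \<le> 1 / (2 * real h + 1)"
    by (simp_all add: b_def)
qed

text \<open>The bias \<open>b/2\<close> is the one produced by a parity block. Near 1/2 the majority
  probability has slope of order \<open>h * b\<close>, so the mean value theorem gives a gain of
  order \<open>h * b\<^sup>2\<close>, which is bounded below.\<close>

lemma prob_majority_biased:
  fixes h :: nat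
  assumes "1 \<le> h"
  defines "b \<equiv> real ((2 * h) choose h) / 4 ^ h"
  shows "measure_pmf.prob (Pi_pmf {..<2 * h + 1} False (\<lambda>_. bernoulli_pmf (1/2 + b/2)))
           {x. majority (2 * h + 1) x} \<ge> 1/2 + 1/8"
proof -
  define F where "F = (\<lambda>p. \<Sum>j=h+1..2*h+1. real ((2 * h + 1) choose j) * p ^ j * (1 - p) ^ (2 * h + 1 - j))"
  have lo: "1 / (4 * real h) \<le> b\<^sup>2" and up: "b\<^sup>2 \<le> 1 / (2 * real h + 1)"
    using central_binomial_bounds[OF assms(1)] by (simp_all add: b_def)
  have "(2 * h) choose h > 0" by (intro zero_less_binomial) simp
  hence b0: "b > 0" by (simp add: b_def)
  have "b\<^sup>2 \<le> 1\<^sup>2" using order_trans[OF up, of 1] by simp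
  hence b1: "b \<le> 1" by (rule power2_le_imp_le) simp
  have "F (1/2) = measure_pmf.prob (Pi_pmf {..<2 * h + 1} False (\<lambda>_. bernoulli_pmf (1/2))) {x. majority (2 * h + 1) x}"
    unfolding F_def by (rule prob_majority_bernoulli[symmetric]) auto
  hence F_half: "F (1/2) = 1/2"
    using prob_coins_majority[of "2 * h + 1"] by (simp add: coins_def)
  have deriv: "(F has_real_derivative real (2 * h + 1) * real ((2 * h) choose h) * (p * (1 - p)) ^ h) (at p)" for p
    unfolding F_def by (rule binomial_tail_deriv)
  obtain z where z: "1/2 < z" "z < 1/2 + b/2"
    "F (1/2 + b/2) - F (1/2) = (1/2 + b/2 - 1/2) *
       (real (2 * h + 1) * real ((2 * h) choose h) * (z * (1 - z)) ^ h)"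
  proof -
    have "\<exists>z>1/2. z < 1/2 + b/2 \<and> F (1/2 + b/2) - F (1/2) = (1/2 + b/2 - 1/2) *
       (real (2 * h + 1) * real ((2 * h) choose h) * (z * (1 - z)) ^ h)"
      using b0 by (intro MVT2 deriv) simp
    thus ?thesis using that by blast
  qed
  \<comment> \<open>\<open>z * (1 - z)\<close> equals 1/4 minus the squared distance of
    \<open>z\<close> from 1/2.\<close>
  have "(1 - b\<^sup>2) / 4 \<le> z * (1 - z)"
  proof -
    have "(z - 1/2)\<^sup>2 \<le> (b/2)\<^sup>2" using z by (intro power_mono) auto
    thus ?thesis by (simp add: power2_eq_square field_simps)
  qed
  moreover have "0 \<le> 1 - b\<^sup>2" using \<open>b\<^sup>2 \<le> 1\<^sup>2\<close> by simp
  ultimately have "((1 - b\<^sup>2) / 4) ^ h \<le> (z * (1 - z)) ^ h" by (intro power_mono) auto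
  \<comment> \<open>The upper bound on \<open>b\<^sup>2\<close> makes \<open>h * b\<^sup>2\<close>
    at most 1/2, so by Bernoulli's inequality the slope loses at most a factor 2 over the
    interval.\<close>
  moreover have "(1/2) / 4 ^ h \<le> ((1 - b\<^sup>2) / 4) ^ h"
  proof -
    have "1/2 \<le> 1 - real h * b\<^sup>2"
    proof -
      have "real h * b\<^sup>2 \<le> real h * (1 / (2 * real h + 1))"
        by (intro mult_left_mono up) simp
      also have "\<dots> \<le> 1/2" by (simp add: field_simps)
      finally show ?thesis by simp
    qed
    also have "\<dots> \<le> (1 - b\<^sup>2) ^ h"
      using Bernoulli_inequality[of "- b\<^sup>2" h] \<open>b\<^sup>2 \<le> 1\<^sup>2\<close> by simp
    finally show ?thesis unfolding power_divide by (rule divide_right_mono) simp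
  qed
  ultimately have pow: "(1/2) / 4 ^ h \<le> (z * (1 - z)) ^ h" by linarith
  \<comment> \<open>The right side exceeds \<open>2 * h / (16 * h) = 1/8\<close>; here the lower
    bound on \<open>b\<^sup>2\<close> enters.\<close>
  have "1/8 \<le> (2 * real h + 1) / 4 * (1 / (4 * real h))"
    using assms(1) by (simp add: field_simps)
  also have "\<dots> \<le> (2 * real h + 1) / 4 * b\<^sup>2"
    using lo by (intro mult_left_mono) auto
  also have "\<dots> = b/2 * (real (2 * h + 1) * real ((2 * h) choose h) * ((1/2) / 4 ^ h))"
    by (simp add: b_def power2_eq_square field_simps)
  also have "\<dots> \<le> b/2 * (real (2 * h + 1) * real ((2 * h) choose h) * (z * (1 - z)) ^ h)"
    using b0 by (intro mult_left_mono pow) auto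
  also have "\<dots> = F (1/2 + b/2) - F (1/2)" using z(3) by simp
  finally have "F (1/2 + b/2) \<ge> 1/2 + 1/8" using F_half by simp
  thus ?thesis
    using b0 b1 by (subst prob_majority_bernoulli) (auto simp: F_def)
qed

subsection \<open>Iterated majority\<close>

lemma along_odd_squares_eq: "along odd_squares = filtermap (\<lambda>j. (2 * j + 1)\<^sup>2) sequentially"
  unfolding filter_eq_iff
proof
  fix P
  have "(\<exists>N. \<forall>n\<ge>N. n \<in> odd_squares \<longrightarrow> P n) \<longleftrightarrow> (\<exists>J. \<forall>j\<ge>J. P ((2 * j + 1)\<^sup>2))"
  proof
    assume "\<exists>N. \<forall>n\<ge>N. n \<in> odd_squares \<longrightarrow> P n"
    then obtain N where N: "\<And>n. n \<ge> N \<Longrightarrow> n \<in> odd_squares \<Longrightarrow> P n" by blast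
    have "P ((2 * j + 1)\<^sup>2)" if "j \<ge> N" for j
    proof (rule N)
      show "N \<le> (2 * j + 1)\<^sup>2" using that by (simp add: power2_eq_square)
      show "(2 * j + 1)\<^sup>2 \<in> odd_squares" by (auto simp: odd_squares_def)
    qed
    thus "\<exists>J. \<forall>j\<ge>J. P ((2 * j + 1)\<^sup>2)" by blast
  next
    assume "\<exists>J. \<forall>j\<ge>J. P ((2 * j + 1)\<^sup>2)"
    then obtain J where J: "\<And>j. j \<ge> J \<Longrightarrow> P ((2 * j + 1)\<^sup>2)" by blast
    have "P n" if n: "n \<ge> (2 * J + 1)\<^sup>2" "n \<in> odd_squares" for n
    proof -
      obtain j where j: "n = (2 * j + 1)\<^sup>2" using n(2) by (auto simp: odd_squares_def elim!: oddE)
      have "2 * J + 1 \<le> 2 * j + 1" using n(1) unfolding j by (rule power2_le_imp_le) simp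
      thus ?thesis using J[of j] j by simp
    qed
    thus "\<exists>N. \<forall>n\<ge>N. n \<in> odd_squares \<longrightarrow> P n" by blast
  qed
  thus "eventually P (along odd_squares) = eventually P (filtermap (\<lambda>j. (2 * j + 1)\<^sup>2) sequentially)"
    by (simp add: along_def eventually_inf_principal eventually_filtermap eventually_sequentially)
qed

section \<open>The limit when \<open>k / m\<close> tends to infinity\<close>

lemma tendsto_prob_Maj2:
  assumes Q: "\<And>j. Q j \<in> kwise_distrs ((2 * j + 1)\<^sup>2) (k j) (1/2)"
    and k: "filterlim (\<lambda>j. k j div (2 * j + 1)) at_top sequentially"
  shows "(\<lambda>j. measure_pmf.prob (Q j) {x. Maj2 ((2 * j + 1)\<^sup>2) x}) \<longlonglongrightarrow> 1/2"
proof -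
  \<comment> \<open>The block majorities are controlled only if \<open>k\<close> covers at least one
    block. The default \<open>coins\<close> lies in every class and is used for only finitely many
    \<open>j\<close>.\<close>
  define R where "R = (\<lambda>j. if k j div (2 * j + 1) \<ge> 1 then map_pmf (block_maj (2 * j + 1)) (Q j)
    else coins {..<2 * j + 1})"
  have "R j \<in> kwise_distrs (2 * j + 1) (k j div (2 * j + 1)) (1/2)" for j
    using block_maj_kwise_distrs[of "2 * j + 1" "k j div (2 * j + 1)" "k j" "Q j"] Q[of j]
    by (auto simp: R_def coins_kwise_distrs power2_eq_square simp del: One_nat_def)
  from tendsto_prob_majority[OF this k]
  show ?thesis
  proof (rule Lim_transform_eventually)
    have "eventually (\<lambda>j. k j div (2 * j + 1) \<ge> 1) sequentially"
      using k by (simp add: filterlim_at_top)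
    thus "\<forall>\<^sub>F j in sequentially. measure_pmf.prob (R j) {x. majority (2 * j + 1) x} =
        measure_pmf.prob (Q j) {x. Maj2 ((2 * j + 1)\<^sup>2) x}"
      by eventually_elim (simp add: R_def Maj2_eq vimage_def del: One_nat_def)
  qed
qed

text \<open>A maximizer and a minimizer chosen for each input size form two sequences of
  distributions. Both give probabilities tending to 1/2, so their difference \<open>eps\<close>
  tends to 0.\<close>

lemma K2_Maj2_of_large:
  assumes "filterlim (\<lambda>n. real (k n) / sqrt (real n)) at_top (along odd_squares)"
  shows "k \<in> K2 odd_squares Maj2 (1/2)"
proof -
  let ?N = "\<lambda>j :: nat. (2 * j + 1)\<^sup>2"
  have k: "filterlim (\<lambda>j. k (?N j) div (2 * j + 1)) at_top sequentially"
    unfolding filterlim_at_top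
  proof
    fix Z
    have "filterlim (\<lambda>j. real (k (?N j)) / real (2 * j + 1)) at_top sequentially"
      using assms by (simp add: along_odd_squares_eq filterlim_filtermap real_sqrt_abs)
    hence "eventually (\<lambda>j. real (k (?N j)) / real (2 * j + 1) \<ge> real Z) sequentially"
      unfolding filterlim_at_top by blast
    thus "eventually (\<lambda>j. Z \<le> k (?N j) div (2 * j + 1)) sequentially"
    proof eventually_elim
      case (elim j)
      moreover have pos: "0 < 2 * j + 1" by simp
      ultimately have "real (Z * (2 * j + 1)) \<le> real (k (?N j))"
        by (simp only: pos_le_divide_eq of_nat_0_less_iff of_nat_mult)
      thus ?case by (simp only: of_nat_le_iff less_eq_div_iff_mult_less_eq[OF pos])
    qed
  qed
  have "\<exists>Q\<in>kwise_distrs (?N j) (k (?N j)) (1/2). \<forall>Q'\<in>kwise_distrs (?N j) (k (?N j)) (1/2).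
      measure_pmf.prob Q' {x. Maj2 (?N j) x} \<le> measure_pmf.prob Q {x. Maj2 (?N j) x}" for j
    by (rule kwise_distrs_attains_max) auto
  then obtain U where U: "\<And>j. U j \<in> kwise_distrs (?N j) (k (?N j)) (1/2)"
    "\<And>j Q. Q \<in> kwise_distrs (?N j) (k (?N j)) (1/2) \<Longrightarrow>
      measure_pmf.prob Q {x. Maj2 (?N j) x} \<le> measure_pmf.prob (U j) {x. Maj2 (?N j) x}"
    by metis
  have "\<exists>Q\<in>kwise_distrs (?N j) (k (?N j)) (1/2). \<forall>Q'\<in>kwise_distrs (?N j) (k (?N j)) (1/2).
      measure_pmf.prob Q {x. Maj2 (?N j) x} \<le> measure_pmf.prob Q' {x. Maj2 (?N j) x}" for j
    by (rule kwise_distrs_attains_min) auto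
  then obtain L where L: "\<And>j. L j \<in> kwise_distrs (?N j) (k (?N j)) (1/2)"
    "\<And>j Q. Q \<in> kwise_distrs (?N j) (k (?N j)) (1/2) \<Longrightarrow>
      measure_pmf.prob (L j) {x. Maj2 (?N j) x} \<le> measure_pmf.prob Q {x. Maj2 (?N j) x}"
    by metis
  have eps: "eps (Maj2 (?N j)) (?N j) (k (?N j)) (1/2) =
      measure_pmf.prob (U j) {x. Maj2 (?N j) x} - measure_pmf.prob (L j) {x. Maj2 (?N j) x}" for j
    unfolding eps_def using U L
    by (intro arg_cong2[of _ _ _ _ "(-)"] cSup_eq_maximum cInf_eq_minimum) auto
  have "(\<lambda>j. eps (Maj2 (?N j)) (?N j) (k (?N j)) (1/2)) \<longlonglongrightarrow> 1/2 - 1/2"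
    unfolding eps by (intro tendsto_diff tendsto_prob_Maj2[OF U(1) k] tendsto_prob_Maj2[OF L(1) k])
  thus ?thesis by (simp add: K2_def along_odd_squares_eq filterlim_filtermap)
qed

section \<open>A constant lower bound on \<open>eps\<close> when \<open>k < m\<close>\<close>

lemma eps_ge_diff:
  assumes "Q \<in> kwise_distrs n k p" "Q' \<in> kwise_distrs n k p"
  shows "measure_pmf.prob Q {x. f x} - measure_pmf.prob Q' {x. f x} \<le> eps f n k p"
  unfolding eps_def using assms
  by (intro diff_mono cSUP_upper cINF_lower bdd_aboveI2[of _ _ 1] bdd_belowI2[of _ 0]) auto

text \<open>Two members of the class are compared: independent parity blocks, with probability at
  least 5/8, and fully independent bits, with probability exactly 1/2.\<close>

lemma eps_Maj2_ge:
  assumes "1 \<le> h" and m: "m = 2 * h + 1" and k: "k < m"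
  shows "1/8 \<le> eps (Maj2 (m\<^sup>2)) (m\<^sup>2) k (1/2)"
proof -
  define b where "b = real ((2 * h) choose h) / 4 ^ h"
  define R where "R = pmf_of_set (parity_class m (even (h + 1)))"
  define Q where "Q = map_pmf (glue m) (Pi_pmf {..<m} (\<lambda>_. False) (\<lambda>_. R))"
  have "Q \<in> kwise_distrs (m * m) (m - 1) (1/2)"
    unfolding Q_def R_def using assms(1) by (intro glue_kwise_distrs map_proj_parity_class) (simp_all add: m)
  hence Q: "Q \<in> kwise_distrs (m\<^sup>2) k (1/2)"
    unfolding power2_eq_square using k by (intro subsetD[OF kwise_distrs_antimono[of k "m - 1"]]) simp_all
  have prob: "measure_pmf.prob S {x. Maj2 (m\<^sup>2) x} =
      measure_pmf.prob (map_pmf (block_maj m) S) {x. majority m x}" for S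
    by (simp add: Maj2_eq vimage_def)
  have "pmf (map_pmf (majority m) R) True = 1/2 + b/2"
    using prob_majority_parity_class[OF m] by (simp add: pmf_map vimage_def R_def b_def)
  hence "map_pmf (majority m) R = bernoulli_pmf (1/2 + b/2)"
    by (metis bool_pmf_eq_bernoulli)
  hence "map_pmf (block_maj m) Q = Pi_pmf {..<m} False (\<lambda>_. bernoulli_pmf (1/2 + b/2))"
    unfolding Q_def map_block_maj_glue by simp
  hence "measure_pmf.prob Q {x. Maj2 (m\<^sup>2) x} \<ge> 1/2 + 1/8"
    using prob_majority_biased[OF assms(1), folded b_def m] by (simp only: prob)
  moreover have "measure_pmf.prob (coins {..<m\<^sup>2}) {x. Maj2 (m\<^sup>2) x} = 1/2"
  proof -
    have odd: "odd m" by (simp add: m)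
    \<comment> \<open>Independence of order \<open>m\<close> among \<open>m\<close> block majorities
      determines their whole law.\<close>
    have "map_pmf (block_maj m) (coins {..<m * m}) \<in> kwise_distrs m m (1/2)"
      using coins_kwise_distrs by (intro block_maj_kwise_distrs[where k = "m * m"] odd) (auto simp: m)
    from map_proj_kwise_distrs[OF this, of "{..<m}"]
    have "map_pmf (proj {..<m}) (map_pmf (block_maj m) (coins {..<m * m})) = coins {..<m}" by simp
    moreover have "proj {..<m} (block_maj m x) = block_maj m x" for x
      by (auto simp: proj_def block_maj_def)
    ultimately have "map_pmf (block_maj m) (coins {..<m * m}) = coins {..<m}"
      by (simp add: pmf.map_comp o_def)
    hence "map_pmf (block_maj m) (coins {..<m\<^sup>2}) = coins {..<m}"
      by (simp only: power2_eq_square)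
    thus ?thesis by (simp only: prob prob_coins_majority[OF odd])
  qed
  ultimately show ?thesis
    using eps_ge_diff[OF Q coins_kwise_distrs, of "Maj2 (m\<^sup>2)"] by simp
qed

lemma not_K2_Maj2_of_small:
  assumes "\<And>n. n \<in> odd_squares \<Longrightarrow> real (k n) < sqrt (real n)"
  shows "k \<notin> K2 odd_squares Maj2 (1/2)"
proof
  assume "k \<in> K2 odd_squares Maj2 (1/2)"
  hence "(\<lambda>j. eps (Maj2 ((2 * j + 1)\<^sup>2)) ((2 * j + 1)\<^sup>2) (k ((2 * j + 1)\<^sup>2)) (1/2)) \<longlonglongrightarrow> 0"
    by (simp add: K2_def along_odd_squares_eq filterlim_filtermap)
  \<comment> \<open>\<open>j \<ge> 1\<close> excludes blocks of length 1, where the construction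
    with \<open>h \<ge> 1\<close> does not apply.\<close>
  moreover have "1/8 \<le> eps (Maj2 ((2 * j + 1)\<^sup>2)) ((2 * j + 1)\<^sup>2) (k ((2 * j + 1)\<^sup>2)) (1/2)"
    if "j \<ge> 1" for j
  proof (rule eps_Maj2_ge[OF that refl])
    have "real (k ((2 * j + 1)\<^sup>2)) < sqrt (real ((2 * j + 1)\<^sup>2))"
      by (rule assms) (auto simp: odd_squares_def)
    also have "sqrt (real ((2 * j + 1)\<^sup>2)) = real (2 * j + 1)"
      by (simp only: of_nat_power real_sqrt_abs abs_of_nat)
    finally show "k ((2 * j + 1)\<^sup>2) < 2 * j + 1" by (simp only: of_nat_less_iff)
  qed
  ultimately have "1/8 \<le> (0 :: real)"
    by (intro LIMSEQ_le_const) blast+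
  thus False by simp
qed

theorem theorem16:
  shows "(\<forall>k :: nat \<Rightarrow> nat.
            (\<forall>n\<in>odd_squares. k n \<le> n) \<and>
            filterlim (\<lambda>n. real (k n) / sqrt (real n)) at_top (along odd_squares)
            \<longrightarrow> k \<in> K2 odd_squares Maj2 (1/2)) \<and>
         (\<forall>k :: nat \<Rightarrow> nat.
            (\<forall>n\<in>odd_squares. real (k n) < sqrt (real n))
            \<longrightarrow> k \<notin> K2 odd_squares Maj2 (1/2))"
  using K2_Maj2_of_large not_K2_Maj2_of_small by blast

end
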